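(* Let $L$ be a first-order language, $M$ an $L$-structure, and $\varphi(x,y)$ an $L(M)$-formula (a formula with parameters from $M$, where $x,y$ are finite tuples of variables). Identify $\varphi(x,y)$ with the family of sets $\mathcal{S}_\varphi=\{\varphi(M,a) : a\in M^{|y|}\}$, where $\varphi(M,a)=\{c\in M^{|x|} : M\models\varphi(c,a)\}$. Suppose that the dual shatter function of $\mathcal{S}_\varphi$ satisfies $\pi^*_\varphi(n)\in o(n^2)$, i.e. $\lim_{n\to\infty}\pi^*_\varphi(n)/n^2=0$, and that $\mathcal{S}_\varphi$ has the $(\omega,2)$-property. Then there exist $m<\omega$ and a partition of $M^{|y|}$ into sets $A_1,\ldots,A_m$, each definable in $M$ with parameters from $M$, such that for every $i\leq m$ the family $\{\varphi(x,a) : a\in A_i\}$ is consistent, i.e. for every finite $F\subseteq A_i$ there is $c\in M^{|x|}$ with $M\models\varphi(c,a)$ for all $a\in F$.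
   Context: For a family of sets $\mathcal{S}$, the boolean atoms of a subfamily $\mathcal{F}$ are the maximal nonempty intersections of sets from $\mathcal{F}$ and their complements (relative to the ambient set, here $M^{|x|}$). The dual shatter function $\pi^*_{\mathcal{S}}:\omega\to\omega$ sends $n$ to the maximum number of boolean atoms of a subfamily of $\mathcal{S}$ of size $n$. A family $\mathcal{S}$ has the $(\omega,2)$-property if among any infinitely many (distinct) sets in $\mathcal{S}$ there are two with nonempty intersection.
   Formalization: The formal theorem additionally assumes that every set φ(M,a) is nonempty; without this the claim fails (e.g. φ := x≠x), and since the conclusion forces each φ(M,a) to be nonempty, no valid case is lost. *)

theory Defs
  imports Complex_Main "HOL-Library.Disjoint_Sets" "HOL-Library.NList"
begin

section \<open>First-order languages and structures\<close>

record ('f, 'r) lang =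
  funs :: "'f set"
  fun_ar :: "'f \<Rightarrow> nat"
  rels :: "'r set"
  rel_ar :: "'r \<Rightarrow> nat"

datatype (dead 'f) tm = Var nat | App 'f "'f tm list"

datatype (dead 'f, dead 'r) fm =
    Eq "'f tm" "'f tm"
  | Rel 'r "'f tm list"
  | Neg "('f, 'r) fm"
  | Conj "('f, 'r) fm" "('f, 'r) fm"
  | Ex nat "('f, 'r) fm"

fun wf_tm :: "('f, 'r) lang \<Rightarrow> 'f tm \<Rightarrow> bool" where
  "wf_tm L (Var v) \<longleftrightarrow> True"
| "wf_tm L (App f ts) \<longleftrightarrow> f \<in> funs L \<and> length ts = fun_ar L f \<and> (\<forall>t\<in>set ts. wf_tm L t)"

fun wf_fm :: "('f, 'r) lang \<Rightarrow> ('f, 'r) fm \<Rightarrow> bool" where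
  "wf_fm L (Eq s t) \<longleftrightarrow> wf_tm L s \<and> wf_tm L t"
| "wf_fm L (Rel r ts) \<longleftrightarrow> r \<in> rels L \<and> length ts = rel_ar L r \<and> (\<forall>t\<in>set ts. wf_tm L t)"
| "wf_fm L (Neg p) \<longleftrightarrow> wf_fm L p"
| "wf_fm L (Conj p q) \<longleftrightarrow> wf_fm L p \<and> wf_fm L q"
| "wf_fm L (Ex v p) \<longleftrightarrow> wf_fm L p"

fun fv_tm :: "'f tm \<Rightarrow> nat set" where
  "fv_tm (Var v) = {v}"
| "fv_tm (App f ts) = (\<Union>t\<in>set ts. fv_tm t)"

fun fv :: "('f, 'r) fm \<Rightarrow> nat set" where
  "fv (Eq s t) = fv_tm s \<union> fv_tm t"
| "fv (Rel r ts) = (\<Union>t\<in>set ts. fv_tm t)"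
| "fv (Neg p) = fv p"
| "fv (Conj p q) = fv p \<union> fv q"
| "fv (Ex v p) = fv p - {v}"

record ('f, 'r, 'm) struct =
  univ :: "'m set"
  fun_int :: "'f \<Rightarrow> 'm list \<Rightarrow> 'm"
  rel_int :: "'r \<Rightarrow> 'm list \<Rightarrow> bool"

definition is_structure :: "('f, 'r) lang \<Rightarrow> ('f, 'r, 'm) struct \<Rightarrow> bool" where
  "is_structure L M \<longleftrightarrow> univ M \<noteq> {} \<and>
     (\<forall>f\<in>funs L. \<forall>as\<in>nlists (fun_ar L f) (univ M). fun_int M f as \<in> univ M)"

fun eval_tm :: "('f, 'r, 'm) struct \<Rightarrow> (nat \<Rightarrow> 'm) \<Rightarrow> 'f tm \<Rightarrow> 'm" where
  "eval_tm M e (Var v) = e v"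
| "eval_tm M e (App f ts) = fun_int M f (map (eval_tm M e) ts)"

fun sat :: "('f, 'r, 'm) struct \<Rightarrow> (nat \<Rightarrow> 'm) \<Rightarrow> ('f, 'r) fm \<Rightarrow> bool" where
  "sat M e (Eq s t) \<longleftrightarrow> eval_tm M e s = eval_tm M e t"
| "sat M e (Rel r ts) \<longleftrightarrow> rel_int M r (map (eval_tm M e) ts)"
| "sat M e (Neg p) \<longleftrightarrow> \<not> sat M e p"
| "sat M e (Conj p q) \<longleftrightarrow> sat M e p \<and> sat M e q"
| "sat M e (Ex v p) \<longleftrightarrow> (\<exists>b\<in>univ M. sat M (e(v := b)) p)"

text \<open>The language \<open>L(M)\<close> adds to \<open>L\<close> a constant \<open>Inr b\<close> for each element \<open>b\<close> of \<open>M\<close>,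
  interpreted by \<open>b\<close> itself.\<close>

definition lang_params :: "('f, 'r) lang \<Rightarrow> ('f, 'r, 'm) struct \<Rightarrow> ('f + 'm, 'r) lang" where
  "lang_params L M =
     \<lparr>funs = funs L <+> univ M, fun_ar = case_sum (fun_ar L) (\<lambda>_. 0),
      rels = rels L, rel_ar = rel_ar L\<rparr>"

definition struct_params :: "('f, 'r, 'm) struct \<Rightarrow> ('f + 'm, 'r, 'm) struct" where
  "struct_params M =
     \<lparr>univ = univ M, fun_int = case_sum (fun_int M) (\<lambda>b _. b), rel_int = rel_int M\<rparr>"

text \<open>Variables outside \<open>vs\<close> get an irrelevant value; the assignment is only used for formulas
  whose free variables lie in \<open>vs\<close>.\<close>

definition tuple_asg :: "nat list \<Rightarrow> 'm list \<Rightarrow> nat \<Rightarrow> 'm" where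
  "tuple_asg vs as v = the (map_of (zip vs as) v)"

definition definable_set :: "('f, 'r) lang \<Rightarrow> ('f, 'r, 'm) struct \<Rightarrow> nat \<Rightarrow> 'm list set \<Rightarrow> bool" where
  "definable_set L M n D \<longleftrightarrow>
     (\<exists>\<psi> zs. wf_fm (lang_params L M) \<psi> \<and> distinct zs \<and> length zs = n \<and> fv \<psi> \<subseteq> set zs \<and>
        D = {as \<in> nlists n (univ M). sat (struct_params M) (tuple_asg zs as) \<psi>})"

definition instance_set ::
  "('f, 'r, 'm) struct \<Rightarrow> ('f + 'm, 'r) fm \<Rightarrow> nat list \<Rightarrow> nat list \<Rightarrow> 'm list \<Rightarrow> 'm list set" where
  "instance_set M \<phi> xs ys a =
     {c \<in> nlists (length xs) (univ M). sat (struct_params M) (tuple_asg (xs @ ys) (c @ a)) \<phi>}"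

definition instance_family ::
  "('f, 'r, 'm) struct \<Rightarrow> ('f + 'm, 'r) fm \<Rightarrow> nat list \<Rightarrow> nat list \<Rightarrow> 'm list set set" where
  "instance_family M \<phi> xs ys = instance_set M \<phi> xs ys ` nlists (length ys) (univ M)"


section \<open>Set families\<close>

text \<open>Maximality refers to the collection of sets being intersected, not to inclusion between the
  resulting intersections.\<close>

definition boolean_atoms :: "'a set \<Rightarrow> 'a set set \<Rightarrow> 'a set set" where
  "boolean_atoms X F =
     {X \<inter> \<Inter>D | D. D \<subseteq> F \<union> (\<lambda>S. X - S) ` F \<and> X \<inter> \<Inter>D \<noteq> {} \<and>
        (\<forall>D'. D \<subset> D' \<and> D' \<subseteq> F \<union> (\<lambda>S. X - S) ` F \<longrightarrow> X \<inter> \<Inter>D' = {})}"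

lemma boolean_atoms_eq:
  assumes "F \<subseteq> Pow X"
  shows "boolean_atoms X F = {A. A \<noteq> {} \<and> (\<exists>G\<subseteq>F. A = (X \<inter> \<Inter>G) - \<Union>(F - G))}"
proof -
  define E where "E = F \<union> (\<lambda>S. X - S) ` F"
  define Dc where "Dc c = {T \<in> E. c \<in> T}" for c
  have compl: "X - T \<in> E" if "T \<in> E" for T
    using that assms by (auto simp: E_def double_diff)
  have dec: "D = Dc c"
    if "D \<subseteq> E" "c \<in> X \<inter> \<Inter>D" "\<forall>D'. D \<subset> D' \<and> D' \<subseteq> E \<longrightarrow> X \<inter> \<Inter>D' = {}" for D c
  proof -
    have "D \<subseteq> Dc c" "Dc c \<subseteq> E" "c \<in> X \<inter> \<Inter>(Dc c)" using that by (auto simp: Dc_def)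
    then show ?thesis using that(3) by blast
  qed
  have mx: "X \<inter> \<Inter>D' = {}" if c: "c \<in> X" and D': "Dc c \<subset> D'" "D' \<subseteq> E" for c D'
  proof -
    obtain T where "T \<in> D'" "T \<notin> Dc c" using D' by blast
    then have "c \<notin> T" "X - T \<in> E" using D' compl by (auto simp: Dc_def)
    then have "X - T \<in> D'" using c D' by (auto simp: Dc_def)
    with \<open>T \<in> D'\<close> show ?thesis by blast
  qed
  have 1: "boolean_atoms X F = (\<lambda>c. X \<inter> \<Inter>(Dc c)) ` X" (is "?l = ?r")
  proof
    show "?l \<subseteq> ?r"
    proof
      fix A assume "A \<in> ?l"
      then obtain D where D: "A = X \<inter> \<Inter>D" "D \<subseteq> E" "X \<inter> \<Inter>D \<noteq> {}"
        "\<forall>D'. D \<subset> D' \<and> D' \<subseteq> E \<longrightarrow> X \<inter> \<Inter>D' = {}"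
        unfolding boolean_atoms_def E_def[symmetric] mem_Collect_eq by (elim exE conjE)
      then obtain c where c: "c \<in> X \<inter> \<Inter>D" by blast
      from dec[OF D(2) c D(4)] D(1) c show "A \<in> ?r" by auto
    qed
    show "?r \<subseteq> ?l"
    proof
      fix A assume "A \<in> ?r"
      then obtain c where c: "c \<in> X" "A = X \<inter> \<Inter>(Dc c)" by blast
      have "Dc c \<subseteq> E" "X \<inter> \<Inter>(Dc c) \<noteq> {}" using c by (auto simp: Dc_def)
      with c mx[OF c(1)] show "A \<in> ?l"
        unfolding boolean_atoms_def E_def[symmetric] mem_Collect_eq
        by (intro exI[of _ "Dc c"]) simp
    qed
  qed
  have 2: "X \<inter> \<Inter>(Dc c) = (X \<inter> \<Inter>{S \<in> F. c \<in> S}) - \<Union>(F - {S \<in> F. c \<in> S})" if c: "c \<in> X" for c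
  proof (intro equalityI subsetI)
    fix z assume "z \<in> X \<inter> \<Inter>(Dc c)"
    then have z: "z \<in> X" "\<And>T. T \<in> E \<Longrightarrow> c \<in> T \<Longrightarrow> z \<in> T" by (auto simp: Dc_def)
    have "z \<in> S \<longleftrightarrow> c \<in> S" if "S \<in> F" for S
      using z(2)[of S] z(2)[of "X - S"] that c by (auto simp: E_def)
    then show "z \<in> (X \<inter> \<Inter>{S \<in> F. c \<in> S}) - \<Union>(F - {S \<in> F. c \<in> S})" using z(1) by simp
  next
    fix z assume z: "z \<in> (X \<inter> \<Inter>{S \<in> F. c \<in> S}) - \<Union>(F - {S \<in> F. c \<in> S})"
    have "z \<in> T" if "T \<in> Dc c" for T
      using that z by (auto simp: Dc_def E_def)
    then show "z \<in> X \<inter> \<Inter>(Dc c)" using z by simp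
  qed
  have 3: "\<exists>c\<in>X. G = {S \<in> F. c \<in> S}" if G: "G \<subseteq> F" "(X \<inter> \<Inter>G) - \<Union>(F - G) \<noteq> {}" for G
  proof -
    obtain c where c: "c \<in> X" "\<forall>S\<in>G. c \<in> S" "\<forall>S\<in>F - G. c \<notin> S" using G(2) by auto
    then show ?thesis using G(1) by (intro bexI[of _ c]) auto
  qed
  show ?thesis
  proof (intro equalityI subsetI)
    fix A assume "A \<in> boolean_atoms X F"
    then obtain c where c: "c \<in> X" "A = X \<inter> \<Inter>(Dc c)" using 1 by auto
    have "A \<noteq> {}" using c by (auto simp: Dc_def)
    moreover have "A = (X \<inter> \<Inter>{S \<in> F. c \<in> S}) - \<Union>(F - {S \<in> F. c \<in> S})"
      by (rule trans[OF c(2) 2[OF c(1)]])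
    moreover have "{S \<in> F. c \<in> S} \<subseteq> F" by auto
    ultimately show "A \<in> {A. A \<noteq> {} \<and> (\<exists>G\<subseteq>F. A = (X \<inter> \<Inter>G) - \<Union>(F - G))}"
      unfolding mem_Collect_eq by (intro conjI exI[of _ "{S \<in> F. c \<in> S}"])
  next
    fix A assume "A \<in> {A. A \<noteq> {} \<and> (\<exists>G\<subseteq>F. A = (X \<inter> \<Inter>G) - \<Union>(F - G))}"
    then obtain G where G: "A \<noteq> {}" "G \<subseteq> F" "A = (X \<inter> \<Inter>G) - \<Union>(F - G)"
      unfolding mem_Collect_eq by (elim exE conjE)
    then obtain c where c: "c \<in> X" "G = {S \<in> F. c \<in> S}" using 3[of G] by auto
    have "A = X \<inter> \<Inter>(Dc c)" using 2[OF c(1)] unfolding G(3) c(2) by (rule sym)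
    then show "A \<in> boolean_atoms X F" unfolding 1 using c(1) by (rule image_eqI)
  qed
qed

text \<open>The supremum below is a maximum whenever \<open>\<S>\<close> has a subfamily of size \<open>n\<close> (for \<open>\<S> \<subseteq> Pow X\<close>, the
  number of atoms is at most \<open>2 ^ n\<close>), and it is \<open>0\<close> if \<open>\<S>\<close> has fewer than \<open>n\<close> members.\<close>

definition dual_shatter :: "'a set \<Rightarrow> 'a set set \<Rightarrow> nat \<Rightarrow> nat" where
  "dual_shatter X \<S> n = Sup {card (boolean_atoms X F) | F. F \<subseteq> \<S> \<and> finite F \<and> card F = n}"

lemma card_boolean_atoms_le:
  assumes "F \<subseteq> Pow X" "finite F"
  shows "finite (boolean_atoms X F)" "card (boolean_atoms X F) \<le> 2 ^ card F"
proof -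
  have sub: "boolean_atoms X F \<subseteq> (\<lambda>G. (X \<inter> \<Inter>G) - \<Union>(F - G)) ` Pow F"
    unfolding boolean_atoms_eq[OF assms(1)] by blast
  then show "finite (boolean_atoms X F)"
    using assms(2) by (auto intro: finite_subset)
  show "card (boolean_atoms X F) \<le> 2 ^ card F"
    using surj_card_le[OF _ sub] assms(2) by (simp add: card_Pow)
qed

definition omega_2_property :: "'a set set \<Rightarrow> bool" where
  "omega_2_property \<S> \<longleftrightarrow>
     (\<forall>\<T>\<subseteq>\<S>. infinite \<T> \<longrightarrow> (\<exists>A\<in>\<T>. \<exists>B\<in>\<T>. A \<noteq> B \<and> A \<inter> B \<noteq> {}))"

end

theory Submission
  imports Defs "HOL-Library.Nat_Bijection"
begin

text \<open>Call a set of parameters small if finitely many definable sets with the finite intersection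
  property cover it. If the space of all parameters is not small, the \<open>(\<omega>,2)\<close>-property yields a
  definable non-small \<open>T\<close> such that every \<open>S a\<close> with \<open>a \<in> T\<close> meets \<open>S b\<close> for all \<open>b \<in> T\<close> outside a
  small set. Take an ultrafilter \<open>U\<close> on the parameters that contains \<open>T\<close> and avoids the small sets,
  and call \<open>Y\<close> large if \<open>S b\<close> meets \<open>Y\<close> for \<open>U\<close>-almost all \<open>b\<close>; so \<open>S a\<close> is large for \<open>a \<in> T\<close>.

  Each finite definable partition of the space of points has a cell that some \<open>S a\<close>, \<open>a \<in> T\<close>, splits
  into two large pieces (otherwise the cells would provide a definable finite cover of a set in \<open>U\<close>
  by sets with the finite intersection property), so \<open>n\<close> sets produce more than \<open>n\<close> large cells.
  Almost every \<open>S b\<close> meets each given large set without containing it. Hence \<open>n\<close> further sets cut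
  every one of these cells into more than \<open>n\<close> pieces, and \<open>2n\<close> sets have at least \<open>n\<^sup>2\<close> atoms.\<close>

section \<open>Ultrafilters and small sets of parameters\<close>

text \<open>Zorn's lemma for the proper filters below \<open>F\<close>: the infimum of a nonempty
  chain is proper because whatever is eventual in it is already eventual in some member. A minimal
  proper filter decides every \<open>Q\<close>, since cutting it down to \<open>Q\<close> cannot
  give a strictly smaller proper one.\<close>

lemma exists_ultrafilter_le:
  fixes F :: "'b filter"
  assumes "F \<noteq> bot"
  obtains U where "U \<le> F" "U \<noteq> bot" "\<And>Q. eventually Q U \<or> eventually (\<lambda>b. \<not> Q b) U"
proof -
  \<comment> \<open>The order is reversed, so that maximal for \<open>R\<close> means minimal as a
    filter.\<close>
  define R where "R G H \<longleftrightarrow> H \<le> G" for G H :: "'b filter"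
  define \<A> where "\<A> = {G. G \<noteq> bot \<and> G \<le> F}"
  have "\<exists>U\<in>\<A>. \<forall>G\<in>\<A>. R U G \<longrightarrow> G = U"
  proof (rule predicate_Zorn)
    show "partial_order_on \<A> (relation_of R \<A>)"
      by (rule partial_order_on_relation_ofI) (auto simp: R_def)
  next
    fix C assume C: "C \<in> Chains (relation_of R \<A>)"
    have sub: "C \<subseteq> \<A>"
      using C by (auto simp: Chains_def relation_of_def)
    show "\<exists>u\<in>\<A>. \<forall>a\<in>C. R a u"
    proof (cases "C = {}")
      case True
      then show ?thesis using assms by (auto simp: \<A>_def)
    next
      case False
      have "eventually Q (Inf C) \<longleftrightarrow> (\<exists>G\<in>C. eventually Q G)" for Q
      proof (rule eventually_Inf_base[OF False])
        fix G H assume "G \<in> C" "H \<in> C"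
        then have "R G H \<or> R H G" using C by (auto simp: Chains_def relation_of_def)
        then show "\<exists>K\<in>C. K \<le> inf G H"
          using \<open>G \<in> C\<close> \<open>H \<in> C\<close> by (auto simp: R_def)
      qed
      then have "Inf C \<noteq> bot"
        using sub by (auto simp: trivial_limit_def \<A>_def)
      moreover have "Inf C \<le> F"
        using False sub by (auto simp: \<A>_def intro: Inf_lower2)
      ultimately show ?thesis
        by (intro bexI[of _ "Inf C"]) (auto simp: R_def \<A>_def intro: Inf_lower)
    qed
  qed
  then obtain U where U: "U \<noteq> bot" "U \<le> F"
    and mx: "\<And>G. G \<noteq> bot \<Longrightarrow> G \<le> U \<Longrightarrow> G = U"
    by (auto simp: \<A>_def R_def intro: order_trans)
  have "eventually Q U" if "\<not> eventually (\<lambda>b. \<not> Q b) U" for Q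
  proof -
    have "inf U (principal {b. Q b}) = U"
      using that by (intro mx) (auto simp: trivial_limit_def eventually_inf_principal)
    moreover have "eventually Q (inf U (principal {b. Q b}))"
      by (simp add: eventually_inf_principal)
    ultimately show ?thesis by simp
  qed
  with U show ?thesis by (intro that) auto
qed

text \<open>This isolates what the combinatorics needs from definability: \<open>\<X>\<close> stands
  for the definable sets of points, \<open>\<D>\<close> for those of parameters. In
  \<open>D_exists_below\<close> the number \<open>k\<close> is fixed, so for a formula the condition
  is first-order: it quantifies over \<open>k\<close> parameter tuples and over points.\<close>

locale definable_family =
  fixes X :: "'a set" and P :: "'b set" and S :: "'b \<Rightarrow> 'a set"
    and \<X> :: "'a set set" and \<D> :: "'b set set"
  assumes X_mem: "X \<in> \<X>"
    and X_subset: "Y \<in> \<X> \<Longrightarrow> Y \<subseteq> X"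
    and X_Int: "Y \<in> \<X> \<Longrightarrow> Z \<in> \<X> \<Longrightarrow> Y \<inter> Z \<in> \<X>"
    and X_Diff: "Y \<in> \<X> \<Longrightarrow> Z \<in> \<X> \<Longrightarrow> Y - Z \<in> \<X>"
    and S_mem: "a \<in> P \<Longrightarrow> S a \<in> \<X>"
    and D_mem: "P \<in> \<D>"
    and D_subset: "D \<in> \<D> \<Longrightarrow> D \<subseteq> P"
    and D_Int: "D \<in> \<D> \<Longrightarrow> E \<in> \<D> \<Longrightarrow> D \<inter> E \<in> \<D>"
    and D_Diff: "D \<in> \<D> \<Longrightarrow> E \<in> \<D> \<Longrightarrow> D - E \<in> \<D>"
    and D_disjnt: "Y \<in> \<X> \<Longrightarrow> {b \<in> P. S b \<inter> Y = {}} \<in> \<D>"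
    and D_superset: "Y \<in> \<X> \<Longrightarrow> {b \<in> P. Y \<subseteq> S b} \<in> \<D>"
    and D_exists_below: "D \<in> \<D> \<Longrightarrow> Y \<in> \<X> \<Longrightarrow> W \<in> \<X> \<Longrightarrow>
      {a \<in> D. \<exists>c. (\<forall>j<(k::nat). c j \<in> D \<and> S (c j) \<inter> Y \<subseteq> S a) \<and>
                   (\<forall>j l. j < l \<and> l < k \<longrightarrow> S (c j) \<inter> S (c l) \<inter> W = {})} \<in> \<D>"
    and S_nonempty: "a \<in> P \<Longrightarrow> S a \<noteq> {}"
    and P_nonempty: "P \<noteq> {}"
begin

lemma X_nonempty: "X \<noteq> {}"
  using P_nonempty S_nonempty S_mem X_subset by blast

lemma X_empty: "{} \<in> \<X>"
  using X_Diff[OF X_mem X_mem] by simp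

lemma X_Un: "Y \<in> \<X> \<Longrightarrow> Z \<in> \<X> \<Longrightarrow> Y \<union> Z \<in> \<X>"
proof -
  assume "Y \<in> \<X>" "Z \<in> \<X>"
  moreover from this have "Y \<union> Z = X - ((X - Y) \<inter> (X - Z))" using X_subset by blast
  ultimately show ?thesis by (simp add: X_Int X_Diff X_mem)
qed

lemma X_Union: "finite \<F> \<Longrightarrow> \<F> \<subseteq> \<X> \<Longrightarrow> \<Union>\<F> \<in> \<X>"
  by (induction \<F> rule: finite_induct) (auto simp: X_empty X_Un)

definition fip :: "'b set \<Rightarrow> bool" where
  "fip A \<longleftrightarrow> (\<forall>F. finite F \<and> F \<subseteq> A \<longrightarrow> (\<exists>c\<in>X. \<forall>a\<in>F. c \<in> S a))"

text \<open>The small sets form an ideal. Only the covering sets have to be definable, not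
  \<open>N\<close> itself.\<close>

definition small :: "'b set \<Rightarrow> bool" where
  "small N \<longleftrightarrow> (\<exists>\<A>. finite \<A> \<and> \<A> \<subseteq> \<D> \<and> (\<forall>A\<in>\<A>. fip A) \<and> N \<subseteq> \<Union>\<A>)"

lemma small_subset: "small N \<Longrightarrow> K \<subseteq> N \<Longrightarrow> small K"
  unfolding small_def by (meson subset_trans)

lemma small_empty: "small {}"
  unfolding small_def by (intro exI[of _ "{}"]) auto

lemma small_Un:
  assumes "small N" "small K"
  shows "small (N \<union> K)"
proof -
  obtain \<A> \<B> where "finite \<A>" "\<A> \<subseteq> \<D>" "\<forall>A\<in>\<A>. fip A" "N \<subseteq> \<Union>\<A>"
    "finite \<B>" "\<B> \<subseteq> \<D>" "\<forall>A\<in>\<B>. fip A" "K \<subseteq> \<Union>\<B>"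
    using assms unfolding small_def by (elim exE conjE) blast
  then show ?thesis
    unfolding small_def by (intro exI[of _ "\<A> \<union> \<B>"]) auto
qed

lemma small_if_fip: "A \<in> \<D> \<Longrightarrow> fip A \<Longrightarrow> small A"
  unfolding small_def by (intro exI[of _ "{A}"]) auto

text \<open>Otherwise every non-small \<open>T\<close> in \<open>\<D>\<close> has an
  \<open>a\<close> for which the \<open>b\<close> in \<open>T\<close> with \<open>S b\<close>
  disjoint from \<open>S a\<close> again form a non-small definable set. Passing to these sets
  repeatedly produces a sequence of pairwise disjoint \<open>S a\<close>.\<close>

lemma not_small_hereditarily_intersecting:
  assumes big: "\<not> small P"
    and no_disjoint_seq: "\<And>a :: nat \<Rightarrow> 'b.
      range a \<subseteq> P \<Longrightarrow> \<exists>i j. i \<noteq> j \<and> S (a i) \<inter> S (a j) \<noteq> {}"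
  shows "\<exists>T\<in>\<D>. \<not> small T \<and> (\<forall>a\<in>T. small {b \<in> T. S b \<inter> S a = {}})"
proof (rule ccontr)
  assume "\<not> ?thesis"
  then have *: "\<exists>a\<in>T. \<not> small {b \<in> T. S b \<inter> S a = {}}" if "T \<in> \<D>" "\<not> small T" for T
    using that by blast
  \<comment> \<open>A state pairs the current non-small set with the element chosen from it.\<close>
  define Q where "Q p \<longleftrightarrow> fst p \<in> \<D> \<and> \<not> small (fst p) \<and> snd p \<in> fst p \<and>
    \<not> small {b \<in> fst p. S b \<inter> S (snd p) = {}}" for p
  have "\<exists>f. \<forall>n::nat. Q (f n) \<and> fst (f (Suc n)) = {b \<in> fst (f n). S b \<inter> S (snd (f n)) = {}}"
  proof (rule dependent_nat_choice)
    obtain a where "a \<in> P" "\<not> small {b \<in> P. S b \<inter> S a = {}}"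
      using *[OF D_mem big] by blast
    then show "\<exists>p. Q p"
      by (intro exI[of _ "(P, a)"]) (simp add: Q_def D_mem big)
  next
    fix p and n :: nat assume p: "Q p"
    let ?T = "{b \<in> fst p. S b \<inter> S (snd p) = {}}"
    have "snd p \<in> P" "fst p \<subseteq> P" using p D_subset by (auto simp: Q_def)
    then have "?T = fst p \<inter> {b \<in> P. S b \<inter> S (snd p) = {}}" by auto
    moreover have "\<dots> \<in> \<D>"
      using p \<open>snd p \<in> P\<close> by (intro D_Int D_disjnt S_mem) (auto simp: Q_def)
    ultimately have T: "?T \<in> \<D>" "\<not> small ?T" using p by (auto simp: Q_def)
    then obtain a where "a \<in> ?T" "\<not> small {b \<in> ?T. S b \<inter> S a = {}}"
      using *[OF T] by blast
    then show "\<exists>q. Q q \<and> fst q = ?T"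
      using T by (intro exI[of _ "(?T, a)"]) (simp add: Q_def)
  qed
  then obtain f where f: "\<And>n. Q (f n)"
    "\<And>n. fst (f (Suc n)) = {b \<in> fst (f n). S b \<inter> S (snd (f n)) = {}}" by blast
  have mono: "fst (f n) \<subseteq> fst (f m)" if "m \<le> n" for m n
    using lift_Suc_antimono_le[of "\<lambda>n. fst (f n)"] f(2) that by auto
  \<comment> \<open>The later element lies in the set of parameters left over after the earlier
    choice.\<close>
  have disj: "S (snd (f n)) \<inter> S (snd (f m)) = {}" if "m < n" for m n
  proof -
    have "snd (f n) \<in> fst (f (Suc m))"
      using mono[of "Suc m" n] f(1)[of n] that by (auto simp: Q_def)
    then show ?thesis using f(2)[of m] by auto
  qed
  have "range (snd \<circ> f) \<subseteq> P"
    using f(1) D_subset by (auto simp: Q_def)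
  from no_disjoint_seq[OF this] obtain i j where "i \<noteq> j" "S (snd (f i)) \<inter> S (snd (f j)) \<noteq> {}"
    by auto
  then show False
    using disj[of i j] disj[of j i] by (cases i j rule: linorder_cases) auto
qed

end

section \<open>Ultrafilters avoiding the small sets\<close>

locale generic_ultrafilter = definable_family X P S \<X> \<D>
  for X :: "'a set" and P :: "'b set" and S \<X> \<D> +
  fixes T :: "'b set" and U :: "'b filter"
  assumes T_mem: "T \<in> \<D>"
    and U_proper: "U \<noteq> bot"
    and U_ultra: "eventually Q U \<or> eventually (\<lambda>b. \<not> Q b) U"
    and U_T: "eventually (\<lambda>b. b \<in> T) U"
    and U_fip: "D \<in> \<D> \<Longrightarrow> fip D \<Longrightarrow> eventually (\<lambda>b. b \<notin> D) U"
    and U_meets: "a \<in> T \<Longrightarrow> eventually (\<lambda>b. S b \<inter> S a \<noteq> {}) U"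

text \<open>The sets containing \<open>T\<close> up to a small set form a filter, proper because
  \<open>T\<close> is not small. It already has the required properties concerning \<open>T\<close>,
  \<open>fip\<close> and intersections, and these pass to any ultrafilter below it.\<close>

lemma (in definable_family) generic_ultrafilter_exists:
  assumes T: "T \<in> \<D>" "\<not> small T" "\<And>a. a \<in> T \<Longrightarrow> small {b \<in> T. S b \<inter> S a = {}}"
  obtains U where "generic_ultrafilter X P S \<X> \<D> T U"
proof -
  define F where "F = Abs_filter (\<lambda>Q. small {b \<in> T. \<not> Q b})"
  have F: "eventually Q F \<longleftrightarrow> small {b \<in> T. \<not> Q b}" for Q
    unfolding F_def
  proof (rule eventually_Abs_filter, unfold_locales)
    show "small {b \<in> T. \<not> True}" by (simp add: small_empty)
  next
    fix Q R assume "small {b \<in> T. \<not> Q b}" "small {b \<in> T. \<not> R b}"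
    from small_Un[OF this] show "small {b \<in> T. \<not> (Q b \<and> R b)}"
      by (rule small_subset) auto
  next
    fix Q R assume "\<forall>b. Q b \<longrightarrow> R b" "small {b \<in> T. \<not> Q b}"
    then show "small {b \<in> T. \<not> R b}" by (auto intro: small_subset)
  qed
  have "F \<noteq> bot" using T(2) by (simp add: trivial_limit_def F)
  then obtain U where U: "U \<le> F" "U \<noteq> bot" "\<And>Q. eventually Q U \<or> eventually (\<lambda>b. \<not> Q b) U"
    using exists_ultrafilter_le by blast
  have le: "small {b \<in> T. \<not> Q b} \<Longrightarrow> eventually Q U" for Q
    using U(1) F by (simp add: le_filter_def)
  have "generic_ultrafilter X P S \<X> \<D> T U"
  proof
    show "eventually (\<lambda>b. b \<notin> D) U" if "D \<in> \<D>" "fip D" for D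
      by (rule le) (rule small_subset[OF small_if_fip[OF that]], auto)
  qed (use T U(2,3) in \<open>auto intro!: le simp: small_empty\<close>)
  then show ?thesis by (rule that)
qed

section \<open>Large sets of points\<close>

context generic_ultrafilter
begin

definition large :: "'a set \<Rightarrow> bool" where
  "large Y \<longleftrightarrow> eventually (\<lambda>b. S b \<inter> Y \<noteq> {}) U"

lemma not_large_iff: "\<not> large Y \<longleftrightarrow> eventually (\<lambda>b. S b \<inter> Y = {}) U"
proof
  show "\<not> large Y \<Longrightarrow> eventually (\<lambda>b. S b \<inter> Y = {}) U"
    using U_ultra[of "\<lambda>b. S b \<inter> Y \<noteq> {}"] by (auto simp: large_def)
  show "eventually (\<lambda>b. S b \<inter> Y = {}) U \<Longrightarrow> \<not> large Y"
  proof
    assume "eventually (\<lambda>b. S b \<inter> Y = {}) U" "large Y"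
    then have "eventually (\<lambda>b. False) U"
      unfolding large_def by eventually_elim auto
    then show False using U_proper by (simp add: trivial_limit_def)
  qed
qed

lemma large_mono: "large Y \<Longrightarrow> Y \<subseteq> Z \<Longrightarrow> large Z"
  unfolding large_def by (erule eventually_mono) auto

lemma not_large_empty: "\<not> large {}"
  by (simp add: not_large_iff)

text \<open>By \<open>not_large_iff\<close>, failing to be large is itself an event of
  \<open>U\<close>, and two such events occur together. So the sets that are not large form an
  ideal.\<close>

lemma large_Un: "large (Y \<union> Z) \<Longrightarrow> large Y \<or> large Z"
proof (rule ccontr)
  assume "large (Y \<union> Z)" "\<not> (large Y \<or> large Z)"
  then have "eventually (\<lambda>b. S b \<inter> Y = {}) U" "eventually (\<lambda>b. S b \<inter> Z = {}) U"
    by (auto simp: not_large_iff)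
  then have "eventually (\<lambda>b. S b \<inter> (Y \<union> Z) = {}) U"
    by eventually_elim auto
  with \<open>large (Y \<union> Z)\<close> show False by (auto simp: not_large_iff[symmetric])
qed

lemma large_UN: "finite I \<Longrightarrow> large (\<Union>i\<in>I. f i) \<Longrightarrow> \<exists>i\<in>I. large (f i)"
proof (induction I rule: finite_induct)
  case (insert i I)
  then show ?case using large_Un[of "f i" "\<Union>i\<in>I. f i"] by auto
qed (simp add: not_large_empty)

lemma large_S: "a \<in> T \<Longrightarrow> large (S a)"
  using U_meets by (simp add: large_def)

lemma T_subset: "T \<subseteq> P" using D_subset[OF T_mem] .

lemma eventually_U_obtains:
  assumes "eventually Q U"
  obtains b where "Q b"
  using assms U_proper eventually_happens by blast

lemma large_X: "large X"
proof -
  obtain a where "a \<in> T" using U_T eventually_U_obtains by blast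
  then have "S a \<subseteq> X" using T_subset S_mem X_subset by blast
  then show ?thesis using large_S[OF \<open>a \<in> T\<close>] large_mono by blast
qed

text \<open>Each \<open>S a\<close> contains \<open>Y\<close> up to a set that is not large. If
  finitely many \<open>S a\<close> had no common point, the finitely many exceptional sets would
  cover the large set \<open>Y\<close>.\<close>

lemma fip_if_not_large_Diff:
  assumes "\<And>a. a \<in> A \<Longrightarrow> large Y \<and> \<not> large (Y - S a)" and "Y \<subseteq> X"
  shows "fip A"
  unfolding fip_def
proof (intro allI impI)
  fix F assume F: "finite F \<and> F \<subseteq> A"
  show "\<exists>c\<in>X. \<forall>a\<in>F. c \<in> S a"
  proof (rule ccontr)
    assume no: "\<not> ?thesis"
    \<comment> \<open>Largeness of \<open>Y\<close> is available only through an element of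
      \<open>F\<close>; for empty \<open>F\<close> any point of \<open>X\<close> serves.\<close>
    then have "F \<noteq> {}" using X_nonempty by auto
    then have "large Y" using F assms(1) by blast
    moreover have "Y \<subseteq> (\<Union>a\<in>F. Y - S a)" using no assms(2) by blast
    ultimately have "large (\<Union>a\<in>F. Y - S a)" by (rule large_mono)
    with large_UN[of F] F assms(1) show False by blast
  qed
qed

text \<open>All \<open>S b\<close> containing \<open>Y\<close> share each point of \<open>Y\<close>,
  so these \<open>b\<close> form a definable set with \<open>fip\<close>, which \<open>U\<close>
  avoids.\<close>

lemma eventually_not_superset:
  assumes "Y \<in> \<X>" "Y \<noteq> {}"
  shows "eventually (\<lambda>b. \<not> Y \<subseteq> S b) U"
proof -
  obtain y where "y \<in> Y" using assms by blast
  have "y \<in> X" using X_subset[OF assms(1)] \<open>y \<in> Y\<close> by blast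
  then have "fip {b \<in> P. Y \<subseteq> S b}"
    unfolding fip_def using \<open>y \<in> Y\<close> by (intro allI impI bexI[of _ y]) auto
  from U_fip[OF D_superset[OF assms(1)] this] U_T show ?thesis
    by eventually_elim (use T_subset in auto)
qed

text \<open>Suppose that no cell is split. Let \<open>I\<close> be a minimal set of cells such that, for all \<open>a\<close> in some
  definable set \<open>D\<close> of the ultrafilter, \<open>S a\<close> is large in a cell from \<open>I\<close>. The set \<open>TY Y\<close> of those \<open>a\<close>
  for which \<open>S a\<close> is large in \<open>Y\<close> has the finite intersection property, but its definition mentions
  \<open>U\<close>. It is definable nevertheless: \<open>a \<in> TY Y\<close> is certified by \<open>card I\<close> many sets of the family that
  are contained in \<open>S a\<close> on \<open>Y\<close> and pairwise disjoint on the other cells of \<open>I\<close>. Such sets exist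
  because, by minimality of \<open>I\<close>, there are generic enough parameters that are large in no cell of \<open>I\<close>
  except \<open>Y\<close>; conversely, by the pigeonhole principle, one of them has to be large in \<open>Y\<close>.\<close>

lemma large_split:
  assumes fin: "finite \<G>" and sub: "\<G> \<subseteq> \<X>" and cover: "\<Union>\<G> = X"
  obtains a Y where "a \<in> T" "Y \<in> \<G>" "large (Y \<inter> S a)" "large (Y - S a)"
proof (rule ccontr)
  assume "\<not> thesis"
  note no_split = that
  with \<open>\<not> thesis\<close> have nosplit: "\<not> large (Y - S a)" if "a \<in> T" "Y \<in> \<G>" "large (Y \<inter> S a)" for a Y
    using no_split[of a Y] that by blast
  define covers where "covers I D \<longleftrightarrow> I \<subseteq> \<G> \<and> D \<in> \<D> \<and> D \<subseteq> T \<and> eventually (\<lambda>b. b \<in> D) U \<and>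
    (\<forall>a\<in>D. \<exists>Y\<in>I. large (Y \<inter> S a))" for I D
  have "covers \<G> T"
  proof -
    have "\<exists>Y\<in>\<G>. large (Y \<inter> S a)" if "a \<in> T" for a
    proof -
      have "S a \<subseteq> X" using that T_subset S_mem X_subset by blast
      then have "large (\<Union>Y\<in>\<G>. Y \<inter> S a)"
        using cover by (intro large_mono[OF large_S[OF that]]) blast
      then show ?thesis using large_UN[OF fin] by blast
    qed
    then show ?thesis using T_mem U_T by (simp add: covers_def)
  qed
  then obtain I where "\<exists>D. covers I D" and min: "\<And>J. (\<exists>D. covers J D) \<Longrightarrow> card I \<le> card J"
    using ex_has_least_nat[of "\<lambda>I. \<exists>D. covers I D" \<G> card] by blast
  then obtain D where D: "covers I D" by blast
  then have I: "I \<subseteq> \<G>" "finite I" "I \<subseteq> \<X>" and D\<D>: "D \<in> \<D>" and DT: "D \<subseteq> T"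
    and evD: "eventually (\<lambda>b. b \<in> D) U" and D_cov: "\<And>a. a \<in> D \<Longrightarrow> \<exists>Y\<in>I. large (Y \<inter> S a)"
    using fin sub by (auto simp: covers_def intro: finite_subset)
  \<comment> \<open>Restricting \<open>D\<close> to the parameters whose set misses \<open>V\<close>
    keeps it definable and in \<open>U\<close>. By minimality of \<open>card I\<close>, the cells
    other than \<open>Y\<close> do not suffice for this restriction.\<close>
  have only: "\<exists>a\<in>D. S a \<inter> V = {} \<and> \<not> large (\<Union>(I - {Y}) \<inter> S a)"
    if Y: "Y \<in> I" and V: "V \<in> \<X>" "\<not> large V" for Y V
  proof -
    let ?E = "D \<inter> {b \<in> P. S b \<inter> V = {}}"
    have "card (I - {Y}) < card I" by (rule card_Diff1_less[OF I(2) Y])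
    then have "\<not> covers (I - {Y}) ?E" using min[of "I - {Y}"] by (metis linorder_not_le)
    moreover have "?E \<in> \<D>" by (intro D_Int D\<D> D_disjnt V)
    moreover have "eventually (\<lambda>b. b \<in> ?E) U"
      using evD V(2)[unfolded not_large_iff] by eventually_elim (use DT T_subset in auto)
    ultimately obtain a where a: "a \<in> ?E" "\<forall>Z\<in>I - {Y}. \<not> large (Z \<inter> S a)"
      using I(1) DT by (auto simp: covers_def)
    have "\<not> large (\<Union>(I - {Y}) \<inter> S a)"
    proof
      assume "large (\<Union>(I - {Y}) \<inter> S a)"
      then have "large (\<Union>Z\<in>I - {Y}. Z \<inter> S a)" by (rule large_mono) blast
      then show False using large_UN[of "I - {Y}"] a(2) I(2) by blast
    qed
    with a(1) show ?thesis by blast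
  qed
  define TY where "TY Y = {a \<in> D. large (Y \<inter> S a)}" for Y
  have def: "TY Y \<in> \<D>" if Y: "Y \<in> I" for Y
  proof -
    define W where "W = \<Union>(I - {Y})"
    define k where "k = card I"
    define good where "good a c n \<longleftrightarrow> (\<forall>j<n. c j \<in> D \<and> S (c j) \<inter> Y \<subseteq> S a) \<and>
      (\<forall>j l. j < l \<and> l < n \<longrightarrow> S (c j) \<inter> S (c l) \<inter> W = {})" for a c and n :: nat
    have W: "W \<in> \<X>" using I by (auto simp: W_def intro!: X_Union)
    have Y\<X>: "Y \<in> \<X>" using Y I by blast
    have "\<exists>c. good a c n" if a: "a \<in> TY Y" for a n
    proof -
      have aP: "a \<in> P" and aT: "a \<in> T" using a DT T_subset by (auto simp: TY_def)
      have nl: "\<not> large (Y - S a)" using a aT Y I by (intro nosplit) (auto simp: TY_def)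
      \<comment> \<open>The extra invariant, that no chosen set is large on \<open>W\<close>, is
        what allows the next set to avoid all of them there.\<close>
      have "\<exists>c. good a c n \<and> (\<forall>j<n. \<not> large (W \<inter> S (c j)))"
      proof (induction n)
        case 0
        show ?case by (simp add: good_def)
      next
        case (Suc n)
        then obtain c where c: "good a c n" "\<forall>j<n. \<not> large (W \<inter> S (c j))" by blast
        \<comment> \<open>What the next set has to miss: the part of \<open>Y\<close> outside
          \<open>S a\<close>, and the earlier sets on \<open>W\<close>. Neither contribution is
          large.\<close>
        define V where "V = (Y - S a) \<union> \<Union>((\<lambda>j. W \<inter> S (c j)) ` {..<n})"
        have cP: "c j \<in> P" if "j < n" for j
          using c(1) that DT T_subset by (auto simp: good_def)
        have "V \<in> \<X>"
          unfolding V_def by (intro X_Un X_Diff X_Union) (auto simp: Y\<X> S_mem aP cP W X_Int)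
        moreover have "\<not> large V"
          unfolding V_def using large_Un large_UN[of "{..<n}" "\<lambda>j. W \<inter> S (c j)"] nl c(2) by blast
        ultimately obtain d where d: "d \<in> D" "S d \<inter> V = {}" "\<not> large (W \<inter> S d)"
          using only[OF Y] unfolding W_def by blast
        have "S d \<inter> Y \<subseteq> S a" "\<And>j. j < n \<Longrightarrow> S (c j) \<inter> S d \<inter> W = {}"
          using d(2) by (auto simp: V_def)
        then show ?case
          using c d by (intro exI[of _ "c(n := d)"]) (auto simp: good_def less_Suc_eq)
      qed
      then show ?thesis by blast
    qed
    moreover have "a \<in> TY Y" if a: "a \<in> D" "good a c k" for a c
    proof (rule ccontr)
      assume "a \<notin> TY Y"
      then have nl: "\<not> large (Y \<inter> S a)" using a by (simp add: TY_def)
      have "\<exists>Z\<in>I - {Y}. large (Z \<inter> S (c j))" if j: "j < k" for j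
      proof -
        have "c j \<in> D" "S (c j) \<inter> Y \<subseteq> S a" using a(2) j by (auto simp: good_def)
        from D_cov[OF this(1)] obtain Z where Z: "Z \<in> I" "large (Z \<inter> S (c j))" by blast
        moreover have "Z \<noteq> Y"
        proof
          assume "Z = Y"
          then have "large (Y \<inter> S a)"
            using Z(2) \<open>S (c j) \<inter> Y \<subseteq> S a\<close> by (auto elim: large_mono)
          with nl show False by blast
        qed
        ultimately show ?thesis by blast
      qed
      then obtain z where z: "\<And>j. j < k \<Longrightarrow> z j \<in> I - {Y} \<and> large (z j \<inter> S (c j))" by metis
      \<comment> \<open>There are \<open>k\<close> sets but only \<open>k - 1\<close> cells besides
        \<open>Y\<close>, so two of the sets are large in the same cell. As that cell is not split,
        one of them fills it up to a set that is not large, so the two meet there, against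
        disjointness on \<open>W\<close>.\<close>
      have "card (I - {Y}) < card {..<k}"
        using card_Diff1_less[OF I(2) Y] by (simp only: k_def card_lessThan)
      moreover have "z ` {..<k} \<subseteq> I - {Y}" using z by blast
      ultimately have "\<not> inj_on z {..<k}"
        using I(2) card_inj_on_le[of z "{..<k}" "I - {Y}"] by auto
      then obtain j l where jl: "j < l" "l < k" "z j = z l"
        unfolding inj_on_def by (metis lessThan_iff nat_neq_iff)
      have "c j \<in> T" using a(2) jl DT by (auto simp: good_def)
      then have "\<not> large (z j - S (c j))"
        using z[of j] jl I(1) by (intro nosplit) auto
      moreover have "large ((z j \<inter> S (c l) \<inter> S (c j)) \<union> (z j - S (c j)))"
        using jl by (intro large_mono[OF conjunct2[OF z[OF jl(2)]]]) auto
      ultimately have "large (z j \<inter> S (c l) \<inter> S (c j))" using large_Un by blast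
      moreover have "z j \<inter> S (c l) \<inter> S (c j) = {}"
      proof -
        have "z j \<subseteq> W" using z[of j] jl by (auto simp: W_def)
        moreover have "S (c j) \<inter> S (c l) \<inter> W = {}" using a(2) jl by (auto simp: good_def)
        ultimately show ?thesis by blast
      qed
      ultimately show False using not_large_empty by simp
    qed
    ultimately have "TY Y = {a \<in> D. \<exists>c. good a c k}" by (auto simp: TY_def)
    then show ?thesis unfolding good_def using D_exists_below[OF D\<D> Y\<X> W] by simp
  qed
  have "fip (TY Y)" if "Y \<in> I" for Y
  proof (rule fip_if_not_large_Diff)
    show "Y \<subseteq> X" using that I X_subset by blast
    show "large Y \<and> \<not> large (Y - S a)" if "a \<in> TY Y" for a
    proof
      show "large Y" using that by (auto simp: TY_def elim: large_mono)
      show "\<not> large (Y - S a)"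
        using that \<open>Y \<in> I\<close> I(1) DT by (intro nosplit) (auto simp: TY_def)
    qed
  qed
  \<comment> \<open>The finitely many sets \<open>TY Y\<close> cover \<open>D\<close>, yet
    \<open>U\<close> contains \<open>D\<close> and avoids each of them.\<close>
  then have "eventually (\<lambda>b. \<forall>Y\<in>I. b \<notin> TY Y) U"
    using def U_fip I(2) by (simp add: eventually_ball_finite)
  with evD have "eventually (\<lambda>b. False) U"
    by eventually_elim (use D_cov in \<open>auto simp: TY_def\<close>)
  then show False using U_proper by (simp add: trivial_limit_def)
qed

section \<open>Many points separated by few sets\<close>

definition separated :: "'b set \<Rightarrow> 'a \<Rightarrow> 'a \<Rightarrow> bool" where
  "separated A y z \<longleftrightarrow> (\<exists>a\<in>A. (y \<in> S a) \<noteq> (z \<in> S a))"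

lemma separated_mono: "separated A y z \<Longrightarrow> A \<subseteq> B \<Longrightarrow> separated B y z"
  unfolding separated_def by blast

text \<open>Each application of \<open>large_split\<close> cuts one cell in two at the cost of one
  parameter. That parameter may already belong to \<open>A\<close>, since a cell need not be an
  atom; hence only an upper bound on \<open>card A\<close>.\<close>

lemma many_large_cells:
  "\<exists>A \<G>. finite A \<and> card A \<le> n \<and> A \<subseteq> P \<and> finite \<G> \<and> card \<G> = Suc n \<and> \<G> \<subseteq> \<X> \<and> \<Union>\<G> = X \<and>
     (\<forall>Y\<in>\<G>. large Y) \<and> (\<forall>Y\<in>\<G>. \<forall>Z\<in>\<G>. Y \<noteq> Z \<longrightarrow> (\<forall>y\<in>Y. \<forall>z\<in>Z. separated A y z))"
proof (induction n)
  case 0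
  show ?case
    by (intro exI[of _ "{}"] exI[of _ "{X}"]) (auto simp: X_mem large_X)
next
  case (Suc n)
  then obtain A \<G> where A: "finite A" "card A \<le> n" "A \<subseteq> P"
    and G: "finite \<G>" "card \<G> = Suc n" "\<G> \<subseteq> \<X>" "\<Union>\<G> = X" "\<forall>Y\<in>\<G>. large Y"
    and sep_all: "\<forall>Y\<in>\<G>. \<forall>Z\<in>\<G>. Y \<noteq> Z \<longrightarrow> (\<forall>y\<in>Y. \<forall>z\<in>Z. separated A y z)"
    by (elim exE conjE) (rule that)
  have sep: "separated A y z" if "Y \<in> \<G>" "Z \<in> \<G>" "Y \<noteq> Z" "y \<in> Y" "z \<in> Z" for Y Z y z
    using sep_all that by blast
  obtain a Y where a: "a \<in> T" "Y \<in> \<G>" "large (Y \<inter> S a)" "large (Y - S a)"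
    using large_split[OF G(1,3,4)] .
  have aP: "a \<in> P" using a(1) T_subset by blast
  let ?H = "insert (Y \<inter> S a) (insert (Y - S a) (\<G> - {Y}))"
  have ne: "Y \<inter> S a \<noteq> {}" "Y - S a \<noteq> {}"
    using a(3,4) not_large_empty by metis+
  \<comment> \<open>Distinct cells separate their points, and no point is separated from itself, so
    a nonempty piece of \<open>Y\<close> is not another cell.\<close>
  have notin: "Z \<notin> \<G> - {Y}" if "Z \<subseteq> Y" "Z \<noteq> {}" for Z
  proof
    assume Z: "Z \<in> \<G> - {Y}"
    obtain z where "z \<in> Z" using \<open>Z \<noteq> {}\<close> by blast
    then have "separated A z z" using sep[of Z Y z z] Z a(2) \<open>Z \<subseteq> Y\<close> by auto
    then show False by (simp add: separated_def)
  qed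
  have "card ?H = Suc (Suc n)"
  proof -
    have "Y - S a \<notin> \<G> - {Y}" "Y \<inter> S a \<notin> insert (Y - S a) (\<G> - {Y})"
      using notin[of "Y - S a"] notin[of "Y \<inter> S a"] ne by blast+
    then show ?thesis using G(1,2) a(2) by simp
  qed
  moreover have "finite ?H" using G(1) by simp
  moreover have "?H \<subseteq> \<X>" using G(3) a(2) aP by (auto intro: X_Int X_Diff S_mem)
  moreover have "\<Union>?H = X" using G(4) a(2) by blast
  moreover have "\<forall>Y\<in>?H. large Y" using G(5) a by blast
  moreover have "\<forall>Z\<in>?H. \<forall>Z'\<in>?H. Z \<noteq> Z' \<longrightarrow> (\<forall>y\<in>Z. \<forall>z\<in>Z'. separated (insert a A) y z)"
  proof (intro ballI impI)
    fix Z Z' y z assume *: "Z \<in> ?H" "Z' \<in> ?H" "Z \<noteq> Z'" "y \<in> Z" "z \<in> Z'"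
    \<comment> \<open>\<open>p\<close> sends a cell of the refinement to an old cell containing
      it.\<close>
    define p where "p V = (if V \<subseteq> Y then Y else V)" for V
    have p: "p V \<in> \<G>" "V \<subseteq> p V" if "V \<in> ?H" for V
      using that a(2) by (auto simp: p_def)
    show "separated (insert a A) y z"
    proof (cases "p Z = p Z'")
      case False
      then have "separated A y z" using * p by (intro sep[of "p Z" "p Z'"]) auto
      then show ?thesis by (rule separated_mono) auto
    next
      case True
      have "V \<subseteq> Y \<longleftrightarrow> V = Y \<inter> S a \<or> V = Y - S a" if "V \<in> ?H" "V \<noteq> {}" for V
        using that notin[of V] by auto
      then have "Z \<in> {Y \<inter> S a, Y - S a}" "Z' \<in> {Y \<inter> S a, Y - S a}"
        using True * unfolding p_def by (metis empty_iff insertCI order_refl)+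
      then show ?thesis using * by (auto simp: separated_def)
    qed
  qed
  moreover have "finite (insert a A)" "card (insert a A) \<le> Suc n" "insert a A \<subseteq> P"
    using A aP by (auto simp: card_insert_if)
  ultimately show ?case by (intro exI[of _ "insert a A"] exI[of _ ?H]) blast
qed

text \<open>\<open>Q\<close> holds the points found so far, and \<open>Z\<close> is a large reserve,
  separated from all of them, that can be cut again.\<close>

definition splits_into :: "'b set \<Rightarrow> 'a set \<Rightarrow> nat \<Rightarrow> bool" where
  "splits_into B Y m \<longleftrightarrow> (\<exists>Q Z. Q \<subseteq> Y \<and> finite Q \<and> card Q = m \<and> Z \<in> \<X> \<and> Z \<subseteq> Y \<and> large Z \<and>
     (\<forall>y\<in>Q. \<forall>z\<in>Q. y \<noteq> z \<longrightarrow> separated B y z) \<and> (\<forall>y\<in>Q. \<forall>z\<in>Z. separated B y z))"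

text \<open>Almost every \<open>S b\<close> meets the reserve \<open>Z\<close> without containing
  it. One of the two pieces of \<open>Z\<close> is large and becomes the new reserve; a point of the
  other piece joins \<open>Q\<close>. Holding for almost all \<open>b\<close>, this can be done in
  finitely many cells with the same \<open>b\<close>.\<close>

lemma splits_into_Suc:
  assumes "splits_into B Y m"
  shows "eventually (\<lambda>b. splits_into (insert b B) Y (Suc m)) U"
proof -
  obtain Q Z where Q: "Q \<subseteq> Y" "finite Q" "card Q = m" and Z: "Z \<in> \<X>" "Z \<subseteq> Y" "large Z"
    and sep_all: "\<forall>y\<in>Q. \<forall>z\<in>Q. y \<noteq> z \<longrightarrow> separated B y z" "\<forall>y\<in>Q. \<forall>z\<in>Z. separated B y z"
    using assms unfolding splits_into_def by (elim exE conjE) (rule that)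
  have sep: "y \<in> Q \<Longrightarrow> z \<in> Q \<Longrightarrow> y \<noteq> z \<Longrightarrow> separated B y z"
    "y \<in> Q \<Longrightarrow> z \<in> Z \<Longrightarrow> separated B y z" for y z
    using sep_all by blast+
  have extend: "splits_into (insert b B) Y (Suc m)"
    if q: "q \<in> Z" and V: "V \<in> \<X>" "V \<subseteq> Z" "large V" and b: "\<forall>v\<in>V. (v \<in> S b) \<noteq> (q \<in> S b)" for b q V
  proof -
    have "q \<notin> Q" using sep(2)[of q q] q by (auto simp: separated_def)
    have "separated (insert b B) y z" if "y \<in> insert q Q" "z \<in> insert q Q" "y \<noteq> z" for y z
    proof -
      have "separated B y z"
        using that sep(1)[of y z] sep(2)[of y z] sep(2)[of z y] q by (auto simp: separated_def)
      then show ?thesis by (rule separated_mono) auto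
    qed
    moreover have "separated (insert b B) y z" if "y \<in> insert q Q" "z \<in> V" for y z
      using that sep(2)[of y z] b V(2) by (auto simp: separated_def)
    ultimately show ?thesis
      unfolding splits_into_def using Q Z V q \<open>q \<notin> Q\<close>
      by (intro exI[of _ "insert q Q"] exI[of _ V] conjI ballI impI) auto
  qed
  have "Z \<noteq> {}" using Z(3) not_large_empty by metis
  from eventually_not_superset[OF Z(1) this] Z(3)[unfolded large_def] U_T
  show ?thesis
  proof eventually_elim
    case (elim b)
    then have Sb: "S b \<in> \<X>" using T_subset S_mem by blast
    have "large ((Z \<inter> S b) \<union> (Z - S b))" using Z(3) by (rule large_mono) auto
    then consider "large (Z \<inter> S b)" | "large (Z - S b)" using large_Un by blast
    then show ?case
    proof cases
      case 1
      obtain q where "q \<in> Z" "q \<notin> S b" using elim by blast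
      with 1 Z(1) Sb show ?thesis by (intro extend[of q "Z \<inter> S b"]) (auto intro: X_Int)
    next
      case 2
      obtain q where "q \<in> Z" "q \<in> S b" using elim by blast
      with 2 Z(1) Sb show ?thesis by (intro extend[of q "Z - S b"]) (auto intro: X_Diff)
    qed
  qed
qed

lemma split_simultaneously:
  assumes "finite \<G>" "\<G> \<subseteq> \<X>" "\<And>Y. Y \<in> \<G> \<Longrightarrow> large Y"
  shows "\<exists>B. finite B \<and> card B \<le> m \<and> B \<subseteq> P \<and> (\<forall>Y\<in>\<G>. splits_into B Y m)"
proof (induction m)
  case 0
  have "splits_into {} Y 0" if "Y \<in> \<G>" for Y
    unfolding splits_into_def using that assms
    by (intro exI[of _ "{}"] exI[of _ Y]) auto
  then show ?case by (intro exI[of _ "{}"]) auto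
next
  case (Suc m)
  then obtain B where B: "finite B" "card B \<le> m" "B \<subseteq> P" "\<forall>Y\<in>\<G>. splits_into B Y m" by blast
  have "eventually (\<lambda>b. \<forall>Y\<in>\<G>. splits_into (insert b B) Y (Suc m)) U"
    using B(4) by (intro eventually_ball_finite assms(1)) (auto intro: splits_into_Suc)
  with U_T have "eventually (\<lambda>b. b \<in> T \<and> (\<forall>Y\<in>\<G>. splits_into (insert b B) Y (Suc m))) U"
    by (rule eventually_conj)
  then obtain b where b: "b \<in> T" "\<forall>Y\<in>\<G>. splits_into (insert b B) Y (Suc m)"
    by (auto elim: eventually_U_obtains)
  then show ?case
    using B T_subset by (intro exI[of _ "insert b B"]) (auto simp: card_insert_if)
qed

text \<open>Take \<open>n + 1\<close> cells and \<open>n\<close> points in each: \<open>A\<close>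
  separates points of different cells, \<open>B\<close> points of the same cell. Separated points of
  \<open>X\<close> are those in different atoms of the sets \<open>S a\<close>, so this counts
  atoms.\<close>

lemma many_separated_points:
  "\<exists>A Q. finite A \<and> card A \<le> 2 * n \<and> A \<subseteq> P \<and> finite Q \<and> n ^ 2 \<le> card Q \<and> Q \<subseteq> X \<and>
     (\<forall>y\<in>Q. \<forall>z\<in>Q. y \<noteq> z \<longrightarrow> separated A y z)"
proof -
  obtain A \<G> where A: "finite A" "card A \<le> n" "A \<subseteq> P"
    and G: "finite \<G>" "card \<G> = Suc n" "\<G> \<subseteq> \<X>" "\<Union>\<G> = X" "\<forall>Y\<in>\<G>. large Y"
    and sep_all: "\<forall>Y\<in>\<G>. \<forall>Z\<in>\<G>. Y \<noteq> Z \<longrightarrow> (\<forall>y\<in>Y. \<forall>z\<in>Z. separated A y z)"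
    using many_large_cells[of n] by (elim exE conjE) (rule that)
  have sep: "separated A y z" if "Y \<in> \<G>" "Z \<in> \<G>" "Y \<noteq> Z" "y \<in> Y" "z \<in> Z" for Y Z y z
    using sep_all that by blast
  obtain B where B: "finite B" "card B \<le> n" "B \<subseteq> P" "\<forall>Y\<in>\<G>. splits_into B Y n"
    using split_simultaneously[OF G(1,3), of n] G(5) by auto
  have "\<forall>Y\<in>\<G>. \<exists>Q. Q \<subseteq> Y \<and> finite Q \<and> card Q = n \<and>
    (\<forall>y\<in>Q. \<forall>z\<in>Q. y \<noteq> z \<longrightarrow> separated B y z)"
  proof
    fix Y assume "Y \<in> \<G>"
    with B(4) have "splits_into B Y n" ..
    then show "\<exists>Q. Q \<subseteq> Y \<and> finite Q \<and> card Q = n \<and> (\<forall>y\<in>Q. \<forall>z\<in>Q. y \<noteq> z \<longrightarrow> separated B y z)"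
      unfolding splits_into_def by (elim exE conjE) (intro exI conjI; assumption)
  qed
  from bchoice[OF this] obtain q where "\<forall>Y\<in>\<G>. q Y \<subseteq> Y \<and> finite (q Y) \<and> card (q Y) = n \<and>
    (\<forall>y\<in>q Y. \<forall>z\<in>q Y. y \<noteq> z \<longrightarrow> separated B y z)" ..
  then have q: "q Y \<subseteq> Y" "finite (q Y)" "card (q Y) = n"
    "y \<in> q Y \<Longrightarrow> z \<in> q Y \<Longrightarrow> y \<noteq> z \<Longrightarrow> separated B y z" if "Y \<in> \<G>" for Y y z
    using that by blast+
  have disj: "q Y \<inter> q Z = {}" if "Y \<in> \<G>" "Z \<in> \<G>" "Y \<noteq> Z" for Y Z
  proof -
    have "\<not> separated A y y" for y by (simp add: separated_def)
    then show ?thesis using sep[OF that] q(1)[OF that(1)] q(1)[OF that(2)] by blast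
  qed
  have "card (\<Union>(q ` \<G>)) = (\<Sum>Y\<in>\<G>. card (q Y))"
    using G(1) q(2) disj by (intro card_UN_disjoint) auto
  also have "\<dots> = Suc n * n" using q(3) G(2) by simp
  finally have "n ^ 2 \<le> card (\<Union>(q ` \<G>))" by (simp add: power2_eq_square)
  moreover have "separated (A \<union> B) y z"
    if yz: "y \<in> \<Union>(q ` \<G>)" "z \<in> \<Union>(q ` \<G>)" "y \<noteq> z" for y z
  proof -
    obtain Y Z where YZ: "Y \<in> \<G>" "Z \<in> \<G>" "y \<in> q Y" "z \<in> q Z" using yz by blast
    show ?thesis
    proof (cases "Y = Z")
      case True
      then have "separated B y z" using q(4)[of Y] YZ yz by blast
      then show ?thesis by (rule separated_mono) auto
    next
      case False
      then have "separated A y z" using sep[of Y Z] YZ q(1) by blast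
      then show ?thesis by (rule separated_mono) auto
    qed
  qed
  moreover have "card (A \<union> B) \<le> 2 * n" using card_Un_le[of A B] A B by simp
  moreover have "\<Union>(q ` \<G>) \<subseteq> X" using q(1) G(4) by blast
  ultimately show ?thesis
    using A B G(1) q(2) by (intro exI[of _ "A \<union> B"] exI[of _ "\<Union>(q ` \<G>)"]) auto
qed

end

section \<open>Counting atoms\<close>

text \<open>Sending a point to the atom containing it is injective on pairwise separated
  points.\<close>

lemma card_separated_le_boolean_atoms:
  assumes F: "F \<subseteq> Pow X" "finite F" and Q: "Q \<subseteq> X"
    and sep: "\<And>y z. y \<in> Q \<Longrightarrow> z \<in> Q \<Longrightarrow> y \<noteq> z \<Longrightarrow> \<exists>V\<in>F. (y \<in> V) \<noteq> (z \<in> V)"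
  shows "card Q \<le> card (boolean_atoms X F)"
proof (rule card_inj_on_le)
  let ?G = "\<lambda>c. {V \<in> F. c \<in> V}"
  let ?atom = "\<lambda>c. (X \<inter> \<Inter>(?G c)) - \<Union>(F - ?G c)"
  have self: "c \<in> ?atom c" if "c \<in> Q" for c using that Q by auto
  show "inj_on ?atom Q"
  proof (rule inj_onI, rule ccontr)
    fix y z assume yz: "y \<in> Q" "z \<in> Q" "?atom y = ?atom z" "y \<noteq> z"
    then have "y \<in> ?atom z" using self[of y] by (simp only:)
    then have "(y \<in> V) = (z \<in> V)" if "V \<in> F" for V using that by auto
    with sep[OF yz(1,2,4)] show False by blast
  qed
  show "?atom ` Q \<subseteq> boolean_atoms X F"
  proof
    fix A assume "A \<in> ?atom ` Q"
    then obtain c where c: "c \<in> Q" "A = ?atom c" by (rule imageE)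
    have "A \<noteq> {}" using self[OF c(1)] c(2) by blast
    then show "A \<in> boolean_atoms X F"
      unfolding boolean_atoms_eq[OF F(1)] mem_Collect_eq
      by (intro conjI exI[of _ "?G c"]) (use c(2) in auto)
  qed
  show "finite (boolean_atoms X F)" by (rule card_boolean_atoms_le(1)[OF F])
qed

text \<open>A supremum of natural numbers bounds its members only if they are bounded; here
  \<open>2 ^ card F\<close> is a bound.\<close>

lemma card_boolean_atoms_le_dual_shatter:
  assumes "F \<subseteq> \<S>" "finite F" "\<S> \<subseteq> Pow X"
  shows "card (boolean_atoms X F) \<le> dual_shatter X \<S> (card F)"
  unfolding dual_shatter_def
proof (rule cSup_upper)
  show "card (boolean_atoms X F) \<in>
      {card (boolean_atoms X G) |G. G \<subseteq> \<S> \<and> finite G \<and> card G = card F}"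
    using assms by blast
  show "bdd_above {card (boolean_atoms X G) |G. G \<subseteq> \<S> \<and> finite G \<and> card G = card F}"
  proof (rule bdd_aboveI)
    fix m assume "m \<in> {card (boolean_atoms X G) |G. G \<subseteq> \<S> \<and> finite G \<and> card G = card F}"
    then obtain G where G: "m = card (boolean_atoms X G)" "G \<subseteq> \<S>" "finite G" "card G = card F"
      by blast
    from G(2) assms(3) have "G \<subseteq> Pow X" by blast
    from card_boolean_atoms_le(2)[OF this G(3)] G show "m \<le> 2 ^ card F" by simp
  qed
qed

context generic_ultrafilter
begin

text \<open>The at most \<open>2 * n\<close> parameters give \<open>m \<le> 2 * n\<close> distinct
  sets with at least \<open>n ^ 2\<close> atoms, so the quotient at \<open>m\<close> is at least
  \<open>1 / 4\<close>.\<close>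

lemma not_subquadratic: "\<not> (\<lambda>n. real (dual_shatter X (S ` P) n) / real n ^ 2) \<longlonglongrightarrow> 0"
proof
  assume lim: "(\<lambda>n. real (dual_shatter X (S ` P) n) / real n ^ 2) \<longlonglongrightarrow> 0"
  have SP: "S ` P \<subseteq> Pow X" using S_mem X_subset by blast
  have "eventually (\<lambda>n. real (dual_shatter X (S ` P) n) / real n ^ 2 < 1 / 4) sequentially"
    by (rule order_tendstoD(2)[OF lim]) simp
  then obtain m0 where m0: "\<And>m. m \<ge> m0 \<Longrightarrow> real (dual_shatter X (S ` P) m) / real m ^ 2 < 1 / 4"
    unfolding eventually_sequentially by blast
  \<comment> \<open>Different parameters may define the same set, so \<open>m\<close> could be far
    below \<open>2 * n\<close>. This choice still forces \<open>m0 \<le> m\<close>, because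
    \<open>2 ^ m0 \<le> n ^ 2 \<le> 2 ^ m\<close>; the extra factor \<open>2\<close> gives
    \<open>1 < n\<close> and thereby \<open>m \<noteq> 0\<close>.\<close>
  define n :: nat where "n = 2 ^ Suc m0"
  obtain A Q where A: "finite A" "card A \<le> 2 * n" "A \<subseteq> P" and Q: "n ^ 2 \<le> card Q" "Q \<subseteq> X"
    and sep: "\<forall>y\<in>Q. \<forall>z\<in>Q. y \<noteq> z \<longrightarrow> separated A y z"
    using many_separated_points[of n] by (elim exE conjE) (rule that)
  define F where "F = S ` A"
  have F: "F \<subseteq> S ` P" "F \<subseteq> Pow X" "finite F" using A SP by (auto simp: F_def)
  define m where "m = card F"
  have "card Q \<le> card (boolean_atoms X F)"
  proof (rule card_separated_le_boolean_atoms[OF F(2,3) Q(2)])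
    fix y z assume "y \<in> Q" "z \<in> Q" "y \<noteq> z"
    with sep have "separated A y z" by blast
    then show "\<exists>V\<in>F. (y \<in> V) \<noteq> (z \<in> V)" by (auto simp: separated_def F_def)
  qed
  with Q(1) have atoms: "n ^ 2 \<le> card (boolean_atoms X F)" by linarith
  have n: "2 ^ m0 \<le> n" "1 < n" "n \<le> n ^ 2"
  proof -
    show "2 ^ m0 \<le> n" by (simp add: n_def)
    have "(1::nat) < 2 ^ Suc m0" by (rule one_less_power) auto
    then show "1 < n" by (simp only: n_def)
    show "n \<le> n ^ 2" by (simp add: power2_eq_square)
  qed
  have "2 ^ m0 \<le> n ^ 2" by (rule le_trans[OF n(1,3)])
  also have "\<dots> \<le> 2 ^ m"
    unfolding m_def by (rule le_trans[OF atoms card_boolean_atoms_le(2)[OF F(2,3)]])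
  finally have "m0 \<le> m" by simp
  have "m \<le> 2 * n" using card_image_le[OF A(1), of S] A(2) by (simp add: m_def F_def)
  have "n ^ 2 \<le> dual_shatter X (S ` P) m"
    unfolding m_def by (rule le_trans[OF atoms card_boolean_atoms_le_dual_shatter[OF F(1,3) SP]])
  then have le: "real n ^ 2 \<le> real (dual_shatter X (S ` P) m)"
    by (metis of_nat_le_iff of_nat_power)
  have "m \<noteq> 0"
  proof
    assume "m = 0"
    then have "n ^ 2 \<le> 1"
      using le_trans[OF atoms card_boolean_atoms_le(2)[OF F(2,3)]] by (simp only: m_def) simp
    with n show False by linarith
  qed
  then have "real (dual_shatter X (S ` P) m) < real m ^ 2 / 4"
    using m0[OF \<open>m0 \<le> m\<close>] by (simp add: pos_divide_less_eq)
  also have "\<dots> \<le> (2 * real n) ^ 2 / 4"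
    using \<open>m \<le> 2 * n\<close> by (intro divide_right_mono power_mono) linarith+
  also have "\<dots> = real n ^ 2" by (simp add: power_mult_distrib)
  finally show False using le by linarith
qed

end

section \<open>From smallness to a finite definable partition\<close>

context definable_family
begin

lemma small_P:
  assumes lim: "(\<lambda>n. real (dual_shatter X (S ` P) n) / real n ^ 2) \<longlonglongrightarrow> 0"
    and omega: "omega_2_property (S ` P)"
  shows "small P"
proof (rule ccontr)
  assume big: "\<not> small P"
  have meet: "\<exists>i j. i \<noteq> j \<and> S (a i) \<inter> S (a j) \<noteq> {}" if a: "range a \<subseteq> P" for a :: "nat \<Rightarrow> 'b"
  proof (rule ccontr)
    assume no: "\<not> ?thesis"
    \<comment> \<open>The \<open>(\<omega>,2)\<close>-property concerns distinct sets, not indices;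
      disjoint nonempty sets are distinct.\<close>
    have "inj (\<lambda>i. S (a i))"
    proof (rule injI, rule ccontr)
      fix i j assume "S (a i) = S (a j)" "i \<noteq> j"
      moreover have "S (a i) \<noteq> {}" using a S_nonempty by blast
      ultimately show False using no by blast
    qed
    then have "infinite (range (\<lambda>i. S (a i)))" by (simp add: finite_image_iff)
    moreover have "range (\<lambda>i. S (a i)) \<subseteq> S ` P" using a by blast
    ultimately obtain A B where "A \<in> range (\<lambda>i. S (a i))" "B \<in> range (\<lambda>i. S (a i))"
      "A \<noteq> B" "A \<inter> B \<noteq> {}"
      using omega[unfolded omega_2_property_def, rule_format, of "range (\<lambda>i. S (a i))"] by auto
    then obtain i j where "S (a i) \<noteq> S (a j)" "S (a i) \<inter> S (a j) \<noteq> {}" by blast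
    moreover from this(1) have "i \<noteq> j" by blast
    ultimately show False using no by blast
  qed
  obtain T where T: "T \<in> \<D>" "\<not> small T" "\<forall>a\<in>T. small {b \<in> T. S b \<inter> S a = {}}"
    using not_small_hereditarily_intersecting[OF big meet] by blast
  obtain U where U: "generic_ultrafilter X P S \<X> \<D> T U"
    using generic_ultrafilter_exists[OF T(1,2) bspec[OF T(3)]] .
  from generic_ultrafilter.not_subquadratic[OF U] lim show False by blast
qed

text \<open>Subtracting from each covering set the union of the previous ones preserves
  definability, and \<open>fip\<close> passes to subsets. Differences that become empty are
  dropped.\<close>

lemma small_imp_partition:
  assumes "small P"
  obtains \<P> where "finite \<P>" "\<P> \<subseteq> \<D>" "disjoint \<P>" "{} \<notin> \<P>" "\<forall>A\<in>\<P>. fip A" "\<Union>\<P> = P"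
proof -
  obtain \<A> where \<A>: "finite \<A>" "\<A> \<subseteq> \<D>" "\<forall>A\<in>\<A>. fip A" "P \<subseteq> \<Union>\<A>"
    using assms unfolding small_def by blast
  have UN: "D - \<Union>\<P> \<in> \<D>" if "finite \<P>" "\<P> \<subseteq> \<D>" "D \<in> \<D>" for D \<P>
    using that
  proof (induction \<P> rule: finite_induct)
    case (insert E \<P>)
    have "D - \<Union>(insert E \<P>) = (D - \<Union>\<P>) - E" by blast
    then show ?case using insert D_Diff by simp
  qed simp
  have "\<exists>\<P>. finite \<P> \<and> \<P> \<subseteq> \<D> \<and> disjoint \<P> \<and> {} \<notin> \<P> \<and> (\<forall>A\<in>\<P>. fip A) \<and> \<Union>\<P> = \<Union>\<A>"
    using \<A>(1-3)
  proof (induction \<A> rule: finite_induct)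
    case empty
    show ?case by (intro exI[of _ "{}"]) auto
  next
    case (insert A \<A>)
    then obtain \<P> where \<P>: "finite \<P>" "\<P> \<subseteq> \<D>" "disjoint \<P>" "{} \<notin> \<P>" "\<forall>A\<in>\<P>. fip A" "\<Union>\<P> = \<Union>\<A>"
      by auto
    show ?case
    proof (cases "A - \<Union>\<P> = {}")
      case True
      then have "\<Union>\<P> = \<Union>(insert A \<A>)" using \<P>(6) by auto
      with \<P>(1-5) show ?thesis by (intro exI[of _ \<P>] conjI)
    next
      case False
      have "fip (A - \<Union>\<P>)" using insert.prems by (auto simp: fip_def)
      moreover have "A - \<Union>\<P> \<in> \<D>" using insert.prems \<P> by (intro UN) auto
      moreover have "disjoint (insert (A - \<Union>\<P>) \<P>)"
        using \<P>(3) by (auto simp: disjoint_def)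
      moreover have "\<Union>(insert (A - \<Union>\<P>) \<P>) = \<Union>(insert A \<A>)" using \<P>(6) by auto
      ultimately show ?thesis
        using \<P>(1,2,4,5) False by (intro exI[of _ "insert (A - \<Union>\<P>) \<P>"] conjI) simp_all
    qed
  qed
  then obtain \<P> where \<P>: "finite \<P>" "\<P> \<subseteq> \<D>" "disjoint \<P>" "{} \<notin> \<P>" "\<forall>A\<in>\<P>. fip A" "\<Union>\<P> = \<Union>\<A>"
    by (elim exE conjE) (rule that)
  have "\<Union>\<P> = P"
    using \<P>(6) \<A>(2,4) D_subset by blast
  from that[OF \<P>(1-5) this] show ?thesis .
qed

end

section \<open>Definability\<close>

fun rename_tm :: "(nat \<Rightarrow> nat) \<Rightarrow> 'f tm \<Rightarrow> 'f tm" where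
  "rename_tm \<pi> (Var v) = Var (\<pi> v)"
| "rename_tm \<pi> (App f ts) = App f (map (rename_tm \<pi>) ts)"

fun rename_fm :: "(nat \<Rightarrow> nat) \<Rightarrow> ('f, 'r) fm \<Rightarrow> ('f, 'r) fm" where
  "rename_fm \<pi> (Eq s t) = Eq (rename_tm \<pi> s) (rename_tm \<pi> t)"
| "rename_fm \<pi> (Rel r ts) = Rel r (map (rename_tm \<pi>) ts)"
| "rename_fm \<pi> (Neg p) = Neg (rename_fm \<pi> p)"
| "rename_fm \<pi> (Conj p q) = Conj (rename_fm \<pi> p) (rename_fm \<pi> q)"
| "rename_fm \<pi> (Ex v p) = Ex (\<pi> v) (rename_fm \<pi> p)"

lemma wf_rename_tm: "wf_tm L (rename_tm \<pi> t) = wf_tm L t"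
  by (induction t) auto

lemma wf_rename_fm: "wf_fm L (rename_fm \<pi> p) = wf_fm L p"
  by (induction p) (auto simp: wf_rename_tm)

lemma fv_rename_tm: "fv_tm (rename_tm \<pi> t) = \<pi> ` fv_tm t"
  by (induction t) auto

lemma fv_rename_fm: "inj \<pi> \<Longrightarrow> fv (rename_fm \<pi> p) = \<pi> ` fv p"
  by (induction p) (auto simp: fv_rename_tm dest: injD)

lemma eval_rename_tm: "eval_tm M e (rename_tm \<pi> t) = eval_tm M (e \<circ> \<pi>) t"
proof (induction t)
  case (App f ts)
  then have "map (eval_tm M e \<circ> rename_tm \<pi>) ts = map (eval_tm M (e \<circ> \<pi>)) ts"
    by (simp add: comp_def)
  then show ?case by (simp only: rename_tm.simps eval_tm.simps map_map)
qed simp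

text \<open>Bound variables are renamed as well, so injectivity is what excludes capture: it makes
  updating an assignment commute with renaming.\<close>

lemma sat_rename_fm: "inj \<pi> \<Longrightarrow> sat M e (rename_fm \<pi> p) = sat M (e \<circ> \<pi>) p"
proof (induction p arbitrary: e)
  case (Rel r ts)
  have "eval_tm M e \<circ> rename_tm \<pi> = eval_tm M (e \<circ> \<pi>)" by (auto simp: eval_rename_tm)
  then show ?case by (simp only: rename_fm.simps sat.simps map_map)
next
  case (Ex v p)
  have "e(\<pi> v := b) \<circ> \<pi> = (e \<circ> \<pi>)(v := b)" for b
    using Ex.prems by (auto simp: fun_eq_iff dest: injD)
  then show ?case by (simp only: rename_fm.simps sat.simps Ex.IH[OF Ex.prems])
qed (auto simp: eval_rename_tm)

lemma eval_tm_cong: "(\<And>v. v \<in> fv_tm t \<Longrightarrow> e v = e' v) \<Longrightarrow> eval_tm M e t = eval_tm M e' t"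
proof (induction t)
  case (App f ts)
  then have "map (eval_tm M e) ts = map (eval_tm M e') ts" by auto
  then show ?case by (simp only: eval_tm.simps)
qed simp

lemma sat_cong: "(\<And>v. v \<in> fv p \<Longrightarrow> e v = e' v) \<Longrightarrow> sat M e p = sat M e' p"
proof (induction p arbitrary: e e')
  case (Eq s t)
  have "eval_tm M e s = eval_tm M e' s" "eval_tm M e t = eval_tm M e' t"
    by (rule eval_tm_cong, rule Eq, simp)+
  then show ?case by simp
next
  case (Rel r ts)
  have "eval_tm M e t = eval_tm M e' t" if "t \<in> set ts" for t
    by (rule eval_tm_cong, rule Rel) (use that in auto)
  then have "map (eval_tm M e) ts = map (eval_tm M e') ts" by (rule map_cong[OF refl])
  then show ?case by (simp only: sat.simps)
next
  case (Neg p)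
  have "sat M e p = sat M e' p" by (rule Neg.IH, rule Neg.prems) simp
  then show ?case by simp
next
  case (Conj p q)
  have "sat M e p = sat M e' p" by (rule Conj.IH(1), rule Conj.prems) simp
  moreover have "sat M e q = sat M e' q" by (rule Conj.IH(2), rule Conj.prems) simp
  ultimately show ?case by simp
next
  case (Ex v p)
  have "sat M (e(v := b)) p = sat M (e'(v := b)) p" for b
    by (rule Ex.IH) (simp add: Ex.prems)
  then show ?case by simp
qed

section \<open>Assigning and quantifying tuples of variables\<close>

lemma tuple_asg_map: "v \<in> set vs \<Longrightarrow> tuple_asg vs (map h vs) v = h v"
  by (simp add: tuple_asg_def map_of_zip_map)

lemma map_tuple_asg: "distinct vs \<Longrightarrow> length as = length vs \<Longrightarrow> map (tuple_asg vs as) vs = as"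
  by (rule nth_equalityI) (simp_all add: tuple_asg_def map_of_zip_nth)

text \<open>Unlike \<open>tuple_asg\<close>, this keeps the values of \<open>e\<close> outside the
  tuple. Updating from the left matches the order in which \<open>foldr Ex\<close> binds.\<close>

fun upds :: "(nat \<Rightarrow> 'm) \<Rightarrow> nat list \<Rightarrow> 'm list \<Rightarrow> nat \<Rightarrow> 'm" where
  "upds e (v # vs) (b # bs) = upds (e(v := b)) vs bs"
| "upds e _ _ = e"

lemma upds_notin: "v \<notin> set vs \<Longrightarrow> upds e vs bs v = e v"
  by (induction e vs bs rule: upds.induct) auto

lemma map_upds: "distinct vs \<Longrightarrow> length bs = length vs \<Longrightarrow> map (upds e vs bs) vs = bs"
  by (induction e vs bs rule: upds.induct) (auto simp: upds_notin)

lemma range_upds: "range e \<subseteq> A \<Longrightarrow> set bs \<subseteq> A \<Longrightarrow> range (upds e vs bs) \<subseteq> A"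
proof (induction e vs bs rule: upds.induct)
  case (1 e v vs b bs)
  show ?case
    unfolding upds.simps by (rule 1(1)) (use 1(2,3) in auto)
qed auto

lemma wf_foldr_Ex: "wf_fm L (foldr Ex vs p) = wf_fm L p"
  by (induction vs) auto

lemma fv_foldr_Ex: "fv (foldr Ex vs p) = fv p - set vs"
  by (induction vs) auto

lemma sat_foldr_Ex:
  "sat M e (foldr Ex vs p) \<longleftrightarrow> (\<exists>bs\<in>nlists (length vs) (univ M). sat M (upds e vs bs) p)"
proof (induction vs arbitrary: e)
  case (Cons v vs)
  have "sat M e (foldr Ex (v # vs) p) \<longleftrightarrow>
      (\<exists>b\<in>univ M. \<exists>bs\<in>nlists (length vs) (univ M). sat M (upds (e(v := b)) vs bs) p)"
    by (simp only: foldr.simps o_apply sat.simps Cons.IH)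
  then show ?case by (simp add: nlists_Suc)
qed simp

section \<open>Definable relations between tuples\<close>

locale formula_instances =
  fixes L :: "('f, 'r) lang" and M :: "('f, 'r, 'm) struct" and \<phi> :: "('f + 'm, 'r) fm"
    and xs ys :: "nat list"
  assumes struct: "is_structure L M"
    and wf: "wf_fm (lang_params L M) \<phi>"
    and dist: "distinct (xs @ ys)"
    and fvs: "fv \<phi> \<subseteq> set (xs @ ys)"
begin

text \<open>Assignments are read as sequences of tuples: block \<open>0\<close> is a copy of the variables \<open>xs\<close> and
  every other block a copy of \<open>ys\<close>.\<close>

definition block :: "nat \<Rightarrow> nat list" where
  "block i = map (\<lambda>v. prod_encode (i, v)) (if i = 0 then xs else ys)"

definition tuples :: "nat \<Rightarrow> 'm list set" where
  "tuples i = nlists (length (block i)) (univ M)"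

text \<open>Working with the relation instead of a formula hides the variables: \<open>z 0\<close>
  is a point, \<open>z j\<close> for positive \<open>j\<close> a parameter tuple, and
  \<open>I\<close> lists the blocks that may occur free.\<close>

definition def_rel :: "nat set \<Rightarrow> ((nat \<Rightarrow> 'm list) \<Rightarrow> bool) \<Rightarrow> bool" where
  "def_rel I R \<longleftrightarrow> (\<exists>\<psi>. wf_fm (lang_params L M) \<psi> \<and> fv \<psi> \<subseteq> (\<Union>i\<in>I. set (block i)) \<and>
     (\<forall>e. range e \<subseteq> univ M \<longrightarrow> sat (struct_params M) e \<psi> = R (\<lambda>i. map e (block i))))"

lemma distinct_block: "distinct (block i)"
  using dist by (auto simp: block_def distinct_map inj_on_def)

lemma disjoint_block: "i \<noteq> j \<Longrightarrow> v \<in> set (block i) \<Longrightarrow> v \<notin> set (block j)"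
  by (auto simp: block_def split: if_splits)

lemma tuples_0: "tuples 0 = nlists (length xs) (univ M)"
  by (simp add: tuples_def block_def)

lemma tuples_pos: "0 < i \<Longrightarrow> tuples i = nlists (length ys) (univ M)"
  by (simp add: tuples_def block_def)

lemma univ_nonempty: "univ M \<noteq> {}"
  using struct by (simp add: is_structure_def)

lemma univ_struct_params [simp]: "univ (struct_params M) = univ M"
  by (simp add: struct_params_def)

lemma map_block_in_tuples: "range e \<subseteq> univ M \<Longrightarrow> map e (block i) \<in> tuples i"
  by (auto simp: tuples_def intro!: nlistsI)

lemma def_rel_cong:
  assumes "def_rel I R" "\<And>z. (\<And>i. z i \<in> tuples i) \<Longrightarrow> R z = R' z"
  shows "def_rel I R'"
proof -
  have "R (\<lambda>i. map e (block i)) = R' (\<lambda>i. map e (block i))" if "range e \<subseteq> univ M" for e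
    using assms(2) map_block_in_tuples[OF that] by simp
  then show ?thesis using assms(1) unfolding def_rel_def by metis
qed

lemma def_rel_mono:
  assumes "def_rel I R" "I \<subseteq> J"
  shows "def_rel J R"
proof -
  have "(\<Union>i\<in>I. set (block i)) \<subseteq> (\<Union>i\<in>J. set (block i))" using assms(2) by blast
  then show ?thesis using assms(1) unfolding def_rel_def by (elim exE conjE) (intro exI conjI; simp)
qed

lemma def_rel_True: "def_rel I (\<lambda>z. True)"
  unfolding def_rel_def using univ_nonempty
  \<comment> \<open>A closed formula that holds because the universe is nonempty.\<close>
  by (intro exI[of _ "Ex 0 (Eq (Var 0) (Var 0))"]) auto

lemma def_rel_Not: "def_rel I R \<Longrightarrow> def_rel I (\<lambda>z. \<not> R z)"
proof -
  assume "def_rel I R"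
  then obtain \<psi> where "wf_fm (lang_params L M) \<psi>" "fv \<psi> \<subseteq> (\<Union>i\<in>I. set (block i))"
    "\<forall>e. range e \<subseteq> univ M \<longrightarrow> sat (struct_params M) e \<psi> = R (\<lambda>i. map e (block i))"
    unfolding def_rel_def by blast
  then show ?thesis unfolding def_rel_def by (intro exI[of _ "Neg \<psi>"]) simp
qed

lemma def_rel_conj: "def_rel I R \<Longrightarrow> def_rel I R' \<Longrightarrow> def_rel I (\<lambda>z. R z \<and> R' z)"
proof -
  assume "def_rel I R" "def_rel I R'"
  then obtain \<psi> \<psi>' where "wf_fm (lang_params L M) \<psi>" "fv \<psi> \<subseteq> (\<Union>i\<in>I. set (block i))"
    "\<forall>e. range e \<subseteq> univ M \<longrightarrow> sat (struct_params M) e \<psi> = R (\<lambda>i. map e (block i))"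
    "wf_fm (lang_params L M) \<psi>'" "fv \<psi>' \<subseteq> (\<Union>i\<in>I. set (block i))"
    "\<forall>e. range e \<subseteq> univ M \<longrightarrow> sat (struct_params M) e \<psi>' = R' (\<lambda>i. map e (block i))"
    unfolding def_rel_def by blast
  then show ?thesis unfolding def_rel_def by (intro exI[of _ "Conj \<psi> \<psi>'"]) simp
qed

lemma def_rel_ball:
  "finite J \<Longrightarrow> (\<And>j. j \<in> J \<Longrightarrow> def_rel I (R j)) \<Longrightarrow> def_rel I (\<lambda>z. \<forall>j\<in>J. R j z)"
proof (induction J rule: finite_induct)
  case (insert j J)
  then have "def_rel I (\<lambda>z. R j z \<and> (\<forall>j\<in>J. R j z))" by (intro def_rel_conj) auto
  then show ?case by simp
qed (simp add: def_rel_True)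

text \<open>Quantifying all variables of block \<open>i\<close> changes just the entry
  \<open>i\<close> of the sequence of tuples, because the blocks are disjoint.\<close>

lemma def_rel_ex:
  assumes "def_rel I R"
  shows "def_rel (I - {i}) (\<lambda>z. \<exists>b\<in>tuples i. R (z(i := b)))"
proof -
  obtain \<psi> where \<psi>: "wf_fm (lang_params L M) \<psi>" "fv \<psi> \<subseteq> (\<Union>i\<in>I. set (block i))"
    "\<And>e. range e \<subseteq> univ M \<Longrightarrow> sat (struct_params M) e \<psi> = R (\<lambda>i. map e (block i))"
    using assms unfolding def_rel_def by blast
  have upd: "(\<lambda>j. map (upds e (block i) b) (block j)) = (\<lambda>j. map e (block j))(i := b)"
    if "b \<in> tuples i" for e b
  proof
    fix j
    show "map (upds e (block i) b) (block j) = ((\<lambda>j. map e (block j))(i := b)) j"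
    proof (cases "j = i")
      case True
      then show ?thesis using that by (simp add: map_upds[OF distinct_block] tuples_def)
    next
      case False
      then have "upds e (block i) b v = e v" if "v \<in> set (block j)" for v
        using that disjoint_block by (intro upds_notin) auto
      then show ?thesis using False by simp
    qed
  qed
  have "sat (struct_params M) e (foldr Ex (block i) \<psi>) =
      (\<exists>b\<in>tuples i. R ((\<lambda>j. map e (block j))(i := b)))" if e: "range e \<subseteq> univ M" for e
  proof -
    have "sat (struct_params M) (upds e (block i) b) \<psi> = R ((\<lambda>j. map e (block j))(i := b))"
      if b: "b \<in> tuples i" for b
    proof -
      have "set b \<subseteq> univ M" using b by (simp add: tuples_def)
      from \<psi>(3)[OF range_upds[OF e this]] show ?thesis by (simp only: upd[OF b])
    qed
    then show ?thesis by (simp add: sat_foldr_Ex tuples_def)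
  qed
  moreover have "fv (foldr Ex (block i) \<psi>) \<subseteq> (\<Union>i\<in>I - {i}. set (block i))"
    using \<psi>(2) unfolding fv_foldr_Ex by blast
  ultimately show ?thesis
    unfolding def_rel_def using \<psi>(1)
    by (intro exI[of _ "foldr Ex (block i) \<psi>"]) (simp add: wf_foldr_Ex)
qed

lemma def_rel_ex_many:
  assumes "finite K" "def_rel I R"
  shows "def_rel (I - K) (\<lambda>z. \<exists>w. (\<forall>i\<in>K. w i \<in> tuples i) \<and> R (override_on z w K))"
  using assms(1)
proof (induction K rule: finite_induct)
  case empty
  then show ?case using assms(2) by simp
next
  case (insert i K)
  have "def_rel (I - K - {i}) (\<lambda>z. \<exists>b\<in>tuples i. \<exists>w. (\<forall>i\<in>K. w i \<in> tuples i) \<and>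
      R (override_on (z(i := b)) w K))"
    by (rule def_rel_ex[OF insert.IH])
  moreover have "(\<exists>b\<in>tuples i. \<exists>w. (\<forall>i\<in>K. w i \<in> tuples i) \<and> R (override_on (z(i := b)) w K)) =
      (\<exists>w. (\<forall>i\<in>insert i K. w i \<in> tuples i) \<and> R (override_on z w (insert i K)))" (is "?l = ?r") for z
  proof
    assume ?l
    then obtain b w where "b \<in> tuples i" "\<forall>i\<in>K. w i \<in> tuples i" "R (override_on (z(i := b)) w K)"
      by blast
    moreover have "override_on z (w(i := b)) (insert i K) = override_on (z(i := b)) w K"
      using insert.hyps by (auto simp: override_on_def fun_eq_iff)
    ultimately show ?r using insert.hyps by (intro exI[of _ "w(i := b)"]) auto
  next
    assume ?r
    then obtain w where "\<forall>i\<in>insert i K. w i \<in> tuples i" "R (override_on z w (insert i K))" by blast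
    moreover have "override_on z w (insert i K) = override_on (z(i := w i)) w K"
      using insert.hyps by (auto simp: override_on_def fun_eq_iff)
    ultimately show ?l by auto
  qed
  moreover have "I - insert i K = I - K - {i}" by blast
  ultimately show ?case by simp
qed

text \<open>This is where the constants of \<open>L(M)\<close> enter: each coordinate is compared
  with the constant naming that coordinate of \<open>a\<close>.\<close>

lemma def_rel_eq:
  assumes "a \<in> tuples i"
  shows "def_rel {i} (\<lambda>z. z i = a)"
proof -
  have "def_rel {i} (\<lambda>z. z i ! k = a ! k)" if k: "k < length (block i)" for k
  proof -
    have "a ! k \<in> univ M" using nlistsE_nth_in[OF assms[unfolded tuples_def] k] .
    then have "wf_fm (lang_params L M) (Eq (Var (block i ! k)) (App (Inr (a ! k)) []))"
      by (simp add: lang_params_def InrI)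
    moreover have "fv (Eq (Var (block i ! k)) (App (Inr (a ! k)) [])) \<subseteq> (\<Union>i\<in>{i}. set (block i))"
      using k by simp
    moreover have "sat (struct_params M) e (Eq (Var (block i ! k)) (App (Inr (a ! k)) [])) =
        (map e (block i) ! k = a ! k)" for e
      using k by (simp add: struct_params_def)
    ultimately show ?thesis unfolding def_rel_def by blast
  qed
  then have "def_rel {i} (\<lambda>z. \<forall>k\<in>{..<length (block i)}. z i ! k = a ! k)"
    by (intro def_rel_ball) auto
  then show ?thesis
  proof (rule def_rel_cong)
    fix z assume z: "\<And>i. z i \<in> tuples i"
    have "length (z i) = length (block i)" "length a = length (block i)"
      using z[of i] assms by (simp_all add: tuples_def)
    then show "(\<forall>k\<in>{..<length (block i)}. z i ! k = a ! k) = (z i = a)"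
      by (auto simp: list_eq_iff_nth_eq)
  qed
qed

text \<open>Substitution of a fixed tuple is expressed by quantifying over a block required to equal
  it.\<close>

lemma def_rel_const:
  assumes "def_rel I R" "a \<in> tuples i"
  shows "def_rel (I - {i}) (\<lambda>z. R (z(i := a)))"
proof -
  have "def_rel (insert i I) (\<lambda>z. z i = a \<and> R z)"
    using def_rel_eq[OF assms(2)] assms(1) by (intro def_rel_conj) (auto elim: def_rel_mono)
  from def_rel_ex[OF this, of i] show ?thesis using assms(2) by simp
qed

abbreviation "S \<equiv> instance_set M \<phi> xs ys"
abbreviation "X \<equiv> nlists (length xs) (univ M)"
abbreviation "P \<equiv> nlists (length ys) (univ M)"

lemma def_rel_instance:
  assumes "0 < j"
  shows "def_rel {0, j} (\<lambda>z. z 0 \<in> S (z j))"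
proof -
  \<comment> \<open>\<open>\<pi>\<close> carries \<open>ys\<close> to block \<open>j\<close> and
    \<open>xs\<close> to block \<open>0\<close>; it is injective because the code retains
    \<open>v\<close>.\<close>
  define \<pi> where "\<pi> v = prod_encode (if v \<in> set ys then j else 0, v)" for v
  have inj: "inj \<pi>" by (rule injI) (simp add: \<pi>_def)
  have "fv (rename_fm \<pi> \<phi>) \<subseteq> (\<Union>i\<in>{0, j}. set (block i))"
  proof
    fix w assume "w \<in> fv (rename_fm \<pi> \<phi>)"
    then obtain v where v: "v \<in> fv \<phi>" "w = \<pi> v" by (auto simp: fv_rename_fm[OF inj])
    with fvs have "v \<in> set xs \<or> v \<in> set ys" by auto
    then show "w \<in> (\<Union>i\<in>{0, j}. set (block i))"
      using assms v(2) by (cases "v \<in> set ys") (simp_all add: \<pi>_def block_def)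
  qed
  moreover have "sat (struct_params M) e (rename_fm \<pi> \<phi>) = (map e (block 0) \<in> S (map e (block j)))"
    if e: "range e \<subseteq> univ M" for e
  proof -
    have *: "map e (block 0) @ map e (block j) = map (e \<circ> \<pi>) (xs @ ys)"
      using dist assms by (auto simp: block_def \<pi>_def)
    have "sat (struct_params M) e (rename_fm \<pi> \<phi>) = sat (struct_params M) (e \<circ> \<pi>) \<phi>"
      by (rule sat_rename_fm[OF inj])
    also have "\<dots> = sat (struct_params M) (tuple_asg (xs @ ys) (map (e \<circ> \<pi>) (xs @ ys))) \<phi>"
      by (intro sat_cong tuple_asg_map[symmetric]) (use fvs in blast)
    finally show ?thesis
      using map_block_in_tuples[OF e, of 0] by (simp add: instance_set_def * tuples_0)
  qed
  ultimately show ?thesis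
    unfolding def_rel_def using wf by (intro exI[of _ "rename_fm \<pi> \<phi>"]) (simp add: wf_rename_fm)
qed

section \<open>Definable sets of points and of parameters\<close>

definition def_points :: "'m list set set" where
  "def_points = {Y. Y \<subseteq> X \<and> def_rel {0} (\<lambda>z. z 0 \<in> Y)}"

text \<open>All blocks with positive index are copies of \<open>ys\<close>. Asking for definability
  in each of them allows several members of \<open>D\<close> to occur in one relation.\<close>

definition def_params :: "'m list set set" where
  "def_params = {D. D \<subseteq> P \<and> (\<forall>j>0. def_rel {j} (\<lambda>z. z j \<in> D))}"

lemma def_points_I: "Y \<subseteq> X \<Longrightarrow> def_rel {0} (\<lambda>z. z 0 \<in> Y) \<Longrightarrow> Y \<in> def_points"
  by (simp add: def_points_def)

lemma def_params_I: "D \<subseteq> P \<Longrightarrow> (\<And>j. 0 < j \<Longrightarrow> def_rel {j} (\<lambda>z. z j \<in> D)) \<Longrightarrow> D \<in> def_params"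
  by (simp add: def_params_def)

lemma def_points_rel: "Y \<in> def_points \<Longrightarrow> 0 \<in> I \<Longrightarrow> def_rel I (\<lambda>z. z 0 \<in> Y)"
  using def_rel_mono[of "{0}" _ I] unfolding def_points_def by blast

lemma def_params_rel: "D \<in> def_params \<Longrightarrow> 0 < j \<Longrightarrow> j \<in> I \<Longrightarrow> def_rel I (\<lambda>z. z j \<in> D)"
  using def_rel_mono[of "{j}" _ I] unfolding def_params_def by blast

lemma instance_rel: "0 < j \<Longrightarrow> 0 \<in> I \<Longrightarrow> j \<in> I \<Longrightarrow> def_rel I (\<lambda>z. z 0 \<in> S (z j))"
  by (rule def_rel_mono[OF def_rel_instance]) auto

text \<open>Disjointness and inclusion of definable sets of points both say that no point has a
  certain definable property.\<close>

lemma def_rel_no_point: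
  assumes "def_rel (insert 0 I) R" "0 \<notin> I"
  shows "def_rel I (\<lambda>z. \<not> (\<exists>x\<in>X. R (z(0 := x))))"
  using def_rel_Not[OF def_rel_ex[OF assms(1), of 0]] assms(2) by (simp add: tuples_0)

lemma def_params_exists_below:
  fixes k :: nat
  assumes D: "D \<in> def_params" and Y: "Y \<in> def_points" and W: "W \<in> def_points"
  shows "{a \<in> D. \<exists>c. (\<forall>j<k. c j \<in> D \<and> S (c j) \<inter> Y \<subseteq> S a) \<and>
           (\<forall>j l. j < l \<and> l < k \<longrightarrow> S (c j) \<inter> S (c l) \<inter> W = {})} \<in> def_params"
    (is "?E \<in> _")
proof (rule def_params_I)
  show "?E \<subseteq> P" using D by (auto simp: def_params_def)
next
  fix j :: nat assume j: "0 < j"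
  \<comment> \<open>Block \<open>0\<close> holds the point, block \<open>j\<close> the parameter
    \<open>a\<close>, and blocks \<open>j + 1\<close> to \<open>j + k\<close> the witnesses
    \<open>c 0\<close> to \<open>c (k - 1)\<close>.\<close>
  define f where "f l = Suc (j + l)" for l
  define I where "I = insert j (f ` {..<k})"
  have f: "0 < f l" "l < k \<Longrightarrow> f l \<in> I" for l by (auto simp: f_def I_def)
  have jI: "j \<in> I" "0 \<notin> I" using j by (auto simp: I_def f_def)
  define R1 where "R1 l z \<longleftrightarrow> z (f l) \<in> D \<and>
    \<not> (\<exists>x\<in>X. x \<in> S (z (f l)) \<and> x \<in> Y \<and> \<not> x \<in> S (z j))" for l and z :: "nat \<Rightarrow> 'm list"
  define R2 where "R2 p z \<longleftrightarrow>
    \<not> (\<exists>x\<in>X. x \<in> S (z (f (fst p))) \<and> x \<in> S (z (f (snd p))) \<and> x \<in> W)" for p and z :: "nat \<Rightarrow> 'm list"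
  define R where "R z \<longleftrightarrow> z j \<in> D \<and> (\<forall>l\<in>{..<k}. R1 l z) \<and> (\<forall>p\<in>{(j, l). j < l \<and> l < k}. R2 p z)" for z
  have R1: "def_rel I (R1 l)" if "l < k" for l
  proof -
    have "def_rel (insert 0 I) (\<lambda>z. z 0 \<in> S (z (f l)) \<and> z 0 \<in> Y \<and> \<not> z 0 \<in> S (z j))"
      using f(1) f(2)[OF that] jI(1) j
      by (intro def_rel_conj def_rel_Not instance_rel def_points_rel[OF Y]) simp_all
    from def_rel_conj[OF def_params_rel[OF D f(1) f(2)[OF that]] def_rel_no_point[OF this jI(2)]]
    show ?thesis by (rule def_rel_cong) (use j in \<open>simp add: R1_def f_def\<close>)
  qed
  have R2: "def_rel I (R2 p)" if "fst p < k" "snd p < k" for p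
  proof -
    have "def_rel (insert 0 I) (\<lambda>z. z 0 \<in> S (z (f (fst p))) \<and> z 0 \<in> S (z (f (snd p))) \<and> z 0 \<in> W)"
      using f(1) f(2)[OF that(1)] f(2)[OF that(2)]
      by (intro def_rel_conj instance_rel def_points_rel[OF W]) simp_all
    from def_rel_no_point[OF this jI(2)]
    show ?thesis by (rule def_rel_cong) (simp add: R2_def f_def)
  qed
  have "finite {(j, l). j < l \<and> l < k}"
    by (rule finite_subset[of _ "{..<k} \<times> {..<k}"]) auto
  then have "def_rel I R"
    unfolding R_def using jI j R1 R2
    by (intro def_rel_conj def_rel_ball def_params_rel[OF D]) auto
  from def_rel_ex_many[OF _ this, of "f ` {..<k}"]
  have "def_rel (I - f ` {..<k}) (\<lambda>z. \<exists>w. (\<forall>i\<in>f ` {..<k}. w i \<in> tuples i) \<and>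
    R (override_on z w (f ` {..<k})))" by simp
  moreover have "I - f ` {..<k} = {j}" by (auto simp: I_def f_def)
  ultimately have "def_rel {j} (\<lambda>z. \<exists>w. (\<forall>i\<in>f ` {..<k}. w i \<in> tuples i) \<and>
    R (override_on z w (f ` {..<k})))" by simp
  then show "def_rel {j} (\<lambda>z. z j \<in> ?E)"
  proof (rule def_rel_cong)
    fix z assume "\<And>i. z i \<in> tuples i"
    have SX: "S a \<subseteq> X" for a by (auto simp: instance_set_def)
    have R1': "R1 l z' \<longleftrightarrow> z' (f l) \<in> D \<and> S (z' (f l)) \<inter> Y \<subseteq> S (z' j)" for l z'
      unfolding R1_def using SX by blast
    have R2': "R2 (i, l) z' \<longleftrightarrow> S (z' (f i)) \<inter> S (z' (f l)) \<inter> W = {}" for i l z'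
      unfolding R2_def using SX by auto
    have ov: "override_on z w (f ` {..<k}) (f l) = w (f l)" if "l < k" for w l
      using that by (simp add: override_on_def)
    have ovj: "override_on z w (f ` {..<k}) j = z j" for w
      by (auto simp: override_on_def f_def)
    show "(\<exists>w. (\<forall>i\<in>f ` {..<k}. w i \<in> tuples i) \<and> R (override_on z w (f ` {..<k}))) = (z j \<in> ?E)"
      (is "?l = ?r")
    proof
      assume ?l
      then obtain w where "R (override_on z w (f ` {..<k}))" by blast
      then show ?r
        unfolding R_def by (auto simp: R1' R2' ov ovj intro!: exI[of _ "\<lambda>l. w (f l)"])
    next
      assume ?r
      then obtain c where c: "z j \<in> D" "\<forall>l<k. c l \<in> D \<and> S (c l) \<inter> Y \<subseteq> S (z j)"
        "\<forall>i l. i < l \<and> l < k \<longrightarrow> S (c i) \<inter> S (c l) \<inter> W = {}" by blast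
      define w where "w i = c (i - Suc j)" for i
      have w: "w (f l) = c l" for l by (simp add: w_def f_def)
      have "c l \<in> tuples (f l)" if "l < k" for l
        using that c(2) D by (auto simp: tuples_pos[OF f(1)] def_params_def)
      then show ?l
        unfolding R_def using c by (intro exI[of _ w]) (auto simp: R1' R2' ov ovj w)
    qed
  qed
qed

lemma definable_family:
  assumes ne: "{} \<notin> instance_family M \<phi> xs ys"
  shows "definable_family X P S def_points def_params"
proof
  have SX: "S a \<subseteq> X" for a by (auto simp: instance_set_def)
  have z0: "z 0 \<in> X" if "\<And>i. z i \<in> tuples i" for z using that[of 0] by (simp add: tuples_0)
  have zj: "z j \<in> P" if "\<And>i. z i \<in> tuples i" "0 < j" for z j using that(1)[of j] that(2)
    by (simp add: tuples_pos)
  show "X \<in> def_points"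
    by (rule def_points_I[OF order_refl]) (rule def_rel_cong[OF def_rel_True], simp add: z0)
  show "Y \<subseteq> X" if "Y \<in> def_points" for Y using that by (simp add: def_points_def)
  show "Y \<inter> Z \<in> def_points" "Y - Z \<in> def_points" if "Y \<in> def_points" "Z \<in> def_points" for Y Z
    using that def_rel_conj def_rel_Not by (auto simp: def_points_def)
  show "P \<in> def_params"
    by (rule def_params_I[OF order_refl]) (rule def_rel_cong[OF def_rel_True], simp add: zj)
  show "D \<subseteq> P" if "D \<in> def_params" for D using that by (simp add: def_params_def)
  show "D \<inter> E \<in> def_params" "D - E \<in> def_params" if "D \<in> def_params" "E \<in> def_params" for D E
    using that def_rel_conj def_rel_Not by (auto simp: def_params_def)
  show "S a \<in> def_points" if "a \<in> P" for a
  proof (rule def_points_I[OF SX])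
    have "a \<in> tuples 1" using that by (simp add: tuples_pos)
    moreover have "{0, 1} - {1} = {0 :: nat}" by auto
    ultimately show "def_rel {0} (\<lambda>z. z 0 \<in> S a)"
      using def_rel_const[OF def_rel_instance[of 1], of a 1] by simp
  qed
  show "{b \<in> P. S b \<inter> Y = {}} \<in> def_params" if Y: "Y \<in> def_points" for Y
  proof (rule def_params_I)
    fix j :: nat assume j: "0 < j"
    have "def_rel {0, j} (\<lambda>z. z 0 \<in> S (z j) \<and> z 0 \<in> Y)"
      using j by (intro def_rel_conj instance_rel def_points_rel[OF Y]) auto
    then have "def_rel {j} (\<lambda>z. \<not> (\<exists>x\<in>X. (z(0 := x)) 0 \<in> S ((z(0 := x)) j) \<and> (z(0 := x)) 0 \<in> Y))"
      by (rule def_rel_no_point) (use j in simp)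
    then show "def_rel {j} (\<lambda>z. z j \<in> {b \<in> P. S b \<inter> Y = {}})"
    proof (rule def_rel_cong)
      fix z assume "\<And>i. z i \<in> tuples i"
      then have "z j \<in> P" using zj j by blast
      then show "(\<not> (\<exists>x\<in>X. (z(0 := x)) 0 \<in> S ((z(0 := x)) j) \<and> (z(0 := x)) 0 \<in> Y)) =
          (z j \<in> {b \<in> P. S b \<inter> Y = {}})"
        using j SX[of "z j"] by auto
    qed
  qed auto
  show "{b \<in> P. Y \<subseteq> S b} \<in> def_params" if Y: "Y \<in> def_points" for Y
  proof (rule def_params_I)
    fix j :: nat assume j: "0 < j"
    have "def_rel {0, j} (\<lambda>z. z 0 \<in> Y \<and> \<not> z 0 \<in> S (z j))"
      using j by (intro def_rel_conj def_rel_Not instance_rel def_points_rel[OF Y]) auto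
    then have "def_rel {j} (\<lambda>z. \<not> (\<exists>x\<in>X. (z(0 := x)) 0 \<in> Y \<and> \<not> (z(0 := x)) 0 \<in> S ((z(0 := x)) j)))"
      by (rule def_rel_no_point) (use j in simp)
    then show "def_rel {j} (\<lambda>z. z j \<in> {b \<in> P. Y \<subseteq> S b})"
    proof (rule def_rel_cong)
      fix z assume "\<And>i. z i \<in> tuples i"
      then have "z j \<in> P" using zj j by blast
      moreover have "Y \<subseteq> X" using Y by (simp add: def_points_def)
      ultimately show "(\<not> (\<exists>x\<in>X. (z(0 := x)) 0 \<in> Y \<and> \<not> (z(0 := x)) 0 \<in> S ((z(0 := x)) j))) =
          (z j \<in> {b \<in> P. Y \<subseteq> S b})"
        using j by auto
    qed
  qed auto
  show "S a \<noteq> {}" if "a \<in> P" for a using that ne by (auto simp: instance_family_def)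
  show "P \<noteq> {}" using nlists_not_empty[OF univ_nonempty] by blast
qed (rule def_params_exists_below)

lemma def_params_definable:
  assumes "D \<in> def_params"
  shows "definable_set L M (length ys) D"
proof -
  have "def_rel {1} (\<lambda>z. z 1 \<in> D)" and DP: "D \<subseteq> P" using assms by (auto simp: def_params_def)
  define zs where "zs = block 1"
  obtain \<psi> where \<psi>: "wf_fm (lang_params L M) \<psi>" "fv \<psi> \<subseteq> set zs"
    "\<And>e. range e \<subseteq> univ M \<Longrightarrow> sat (struct_params M) e \<psi> = (map e zs \<in> D)"
    using \<open>def_rel {1} _\<close> unfolding def_rel_def zs_def by auto
  have zs: "distinct zs" "length zs = length ys"
    unfolding zs_def by (rule distinct_block) (simp add: block_def)
  have "sat (struct_params M) (tuple_asg zs as) \<psi> = (as \<in> D)" if as: "as \<in> P" for as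
  proof -
    obtain b where b: "b \<in> univ M" using univ_nonempty by blast
    \<comment> \<open>Off \<open>zs\<close> the values of \<open>tuple_asg\<close> may lie outside
      the universe, where nothing is known about \<open>\<psi>\<close>; \<open>b\<close> replaces
      them.\<close>
    define e where "e v = (if v \<in> set zs then tuple_asg zs as v else b)" for v
    have m: "map (tuple_asg zs as) zs = as"
      using as zs by (intro map_tuple_asg) simp_all
    have "range e \<subseteq> univ M"
    proof (rule image_subsetI)
      fix v
      have "tuple_asg zs as v \<in> set as" if "v \<in> set zs"
        using imageI[OF that, of "tuple_asg zs as"] arg_cong[OF m, of set] by simp
      moreover have "set as \<subseteq> univ M" using as by simp
      ultimately show "e v \<in> univ M" using b by (auto simp: e_def)
    qed
    moreover have "map e zs = map (tuple_asg zs as) zs" by (simp add: e_def)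
    moreover have "sat (struct_params M) e \<psi> = sat (struct_params M) (tuple_asg zs as) \<psi>"
    proof (rule sat_cong)
      fix v assume "v \<in> fv \<psi>"
      with \<psi>(2) have "v \<in> set zs" by blast
      then show "e v = tuple_asg zs as v" by (simp add: e_def)
    qed
    ultimately show ?thesis using \<psi>(3) m by simp
  qed
  then have "D = {as \<in> P. sat (struct_params M) (tuple_asg zs as) \<psi>}" using DP by auto
  then show ?thesis
    unfolding definable_set_def using \<psi>(1,2) zs by (intro exI[of _ \<psi>] exI[of _ zs] conjI)
qed

end

section \<open>The partition for a formula and its enumeration\<close>

theorem theorem3p1:
  fixes L :: "('f, 'r) lang"
    and M :: "('f, 'r, 'm) struct"
    and \<phi> :: "('f + 'm, 'r) fm"
    and xs ys :: "nat list"
  assumes "is_structure L M"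
    and "wf_fm (lang_params L M) \<phi>"
    and "distinct (xs @ ys)"
    and "fv \<phi> \<subseteq> set (xs @ ys)"
    and "{} \<notin> instance_family M \<phi> xs ys"
    and "(\<lambda>n. real (dual_shatter (nlists (length xs) (univ M)) (instance_family M \<phi> xs ys) n)
            / real n ^ 2) \<longlonglongrightarrow> 0"
    and "omega_2_property (instance_family M \<phi> xs ys)"
  shows "\<exists>(m::nat) A. (\<Union>i\<in>{1..m}. A i) = nlists (length ys) (univ M) \<and>
           disjoint_family_on A {1..m} \<and>
           (\<forall>i\<in>{1..m}. A i \<noteq> {} \<and>
              definable_set L M (length ys) (A i) \<and>
              (\<forall>F. finite F \<and> F \<subseteq> A i \<longrightarrow>
                 (\<exists>c\<in>nlists (length xs) (univ M). \<forall>a\<in>F. c \<in> instance_set M \<phi> xs ys a)))"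
proof -
  interpret F: formula_instances L M \<phi> xs ys
    using assms(1-4) by unfold_locales
  interpret definable_family F.X F.P F.S F.def_points F.def_params
    by (rule F.definable_family[OF assms(5)])
  have "small F.P"
    using assms(6,7) unfolding instance_family_def by (rule small_P)
  then obtain \<P> where \<P>: "finite \<P>" "\<P> \<subseteq> F.def_params" "disjoint \<P>" "{} \<notin> \<P>"
    "\<forall>A\<in>\<P>. fip A" "\<Union>\<P> = F.P"
    by (rule small_imp_partition)
  obtain h where h: "bij_betw h {1..card \<P>} \<P>"
    using ex_bij_betw_nat_finite_1[OF \<P>(1)] by blast
  then have im: "h ` {1..card \<P>} = \<P>" and inj: "inj_on h {1..card \<P>}"
    by (auto simp: bij_betw_def)
  show ?thesis
  proof (intro exI[of _ "card \<P>"] exI[of _ h] conjI ballI allI impI)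
    show "(\<Union>i\<in>{1..card \<P>}. h i) = F.P" using im \<P>(6) by simp
    show "disjoint_family_on h {1..card \<P>}"
      unfolding disjoint_family_on_def
    proof (intro ballI impI)
      fix i j assume "i \<in> {1..card \<P>}" "j \<in> {1..card \<P>}" "i \<noteq> j"
      then have "h i \<noteq> h j" "h i \<in> \<P>" "h j \<in> \<P>" using inj im by (auto dest: inj_onD)
      then show "h i \<inter> h j = {}" using \<P>(3) by (auto simp: disjoint_def)
    qed
  next
    fix i assume "i \<in> {1..card \<P>}"
    then have hi: "h i \<in> \<P>" using im by blast
    show "h i \<noteq> {}" using hi \<P>(4) by auto
    show "definable_set L M (length ys) (h i)"
      using hi \<P>(2) by (intro F.def_params_definable) blast
    fix G assume "finite G \<and> G \<subseteq> h i"
    then show "\<exists>c\<in>F.X. \<forall>a\<in>G. c \<in> F.S a"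
      using \<P>(5) hi unfolding fip_def by blast
  qed
qed

end
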